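(* Let $l\ge 2$ and $d_1,\ldots,d_l\ge 2$ be integers. The space of tensorial bodies $\mathcal{B}_{\otimes}(\otimes_{i=1}^{l}\mathbb{R}^{d_{i}})$ is contractible.
   Context: $\otimes_{i=1}^l\mathbb{R}^{d_i}$ is a Euclidean space with the scalar product $\langle\cdot,\cdot\rangle_H$ determined by $\langle x^1\otimes\cdots\otimes x^l,y^1\otimes\cdots\otimes y^l\rangle_H=\prod_{i=1}^l\langle x^i,y^i\rangle$. A $0$-symmetric convex body in a finite-dimensional Euclidean space $\mathbb{E}$ is a compact convex set $Q\subset\mathbb{E}$ with nonempty interior and $Q=-Q$. Its polar is $Q^\circ=\{y\in\mathbb{E}:\sup_{x\in Q}|\langle x,y\rangle|\le 1\}$. For $0$-symmetric convex bodies $Q_i\subset\mathbb{R}^{d_i}$: $Q_1\otimes_\pi\cdots\otimes_\pi Q_l:=\mathrm{conv}\{x^1\otimes\cdots\otimes x^l: x^i\in Q_i\}$ and $Q_1\otimes_\epsilon\cdots\otimes_\epsilon Q_l:=(Q_1^\circ\otimes_\pi\cdots\otimes_\pi Q_l^\circ)^\circ$. A $0$-symmetric convex body $Q\subset\otimes_{i=1}^l\mathbb{R}^{d_i}$ is a tensorial body if there exist $0$-symmetric convex bodies $Q_i\subset\mathbb{R}^{d_i}$ with $Q_1\otimes_\pi\cdots\otimes_\pi Q_l\subseteq Q\subseteq Q_1\otimes_\epsilon\cdots\otimes_\epsilon Q_l$. The set of tensorial bodies is $\mathcal{B}_\otimes(\otimes_{i=1}^l\mathbb{R}^{d_i})$,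 with the topology of the Hausdorff distance $\delta^H(P,Q)=\min\{\lambda\ge0: P\subseteq Q+\lambda B,\ Q\subseteq P+\lambda B\}$, where $B$ is the closed unit ball of $(\otimes_{i=1}^l\mathbb{R}^{d_i},\langle\cdot,\cdot\rangle_H)$. *)

theory Defs
  imports "HOL-Analysis.Analysis"
begin

text \<open>
  The factors of a tensor product may have different dimensions, so the space \<open>\<real>\<^sup>d\<close> is realised
  as the coordinate subspace of \<open>real ^ 'n\<close> belonging to a set of \<open>d\<close> coordinates, where \<open>'n\<close> is
  any finite type with at least \<open>d\<close> elements. It carries the inner product and the topology
  inherited from \<open>real ^ 'n\<close>. Convex bodies, polars and Hausdorff distances are always taken
  relative to the ambient subspace \<open>V\<close>, which plays the role of the Euclidean space.
\<close>

definition coord_space :: "'n::finite set \<Rightarrow> (real ^ 'n) set" where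
  "coord_space S = {x. \<forall>j. j \<notin> S \<longrightarrow> x $ j = 0}"

definition sym_convex_body :: "'a::euclidean_space set \<Rightarrow> 'a set \<Rightarrow> bool" where
  "sym_convex_body V Q \<longleftrightarrow>
     Q \<subseteq> V \<and> compact Q \<and> convex Q \<and> top_of_set V interior_of Q \<noteq> {} \<and> Q = uminus ` Q"

definition polar :: "'a::euclidean_space set \<Rightarrow> 'a set \<Rightarrow> 'a set" where
  "polar V Q = {y \<in> V. \<forall>x\<in>Q. \<bar>x \<bullet> y\<bar> \<le> 1}"

text \<open>
  The infimum is a minimum when \<open>P\<close> and \<open>Q\<close> are nonempty compact subsets of \<open>V\<close>. The value \<open>0\<close>
  is a dummy for sets at infinite distance; this does not happen for convex bodies.
\<close>

definition hausdorff_dist :: "'a::euclidean_space set \<Rightarrow> 'a set \<Rightarrow> 'a set \<Rightarrow> real" where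
  "hausdorff_dist V P Q =
     (let B = V \<inter> cball 0 1;
          L = {r. 0 \<le> r \<and> P \<subseteq> {q + r *\<^sub>R b | q b. q \<in> Q \<and> b \<in> B}
                        \<and> Q \<subseteq> {p + r *\<^sub>R b | p b. p \<in> P \<and> b \<in> B}}
      in if L = {} then 0 else Inf L)"

text \<open>
  With factors indexed by \<open>'l\<close>, the multi-indices are the functions \<open>'l \<Rightarrow> 'n\<close>. The standard inner
  product of \<open>real ^ ('l \<Rightarrow> 'n)\<close> is the Hilbert tensor product: see \<open>inner_tensor\<close> below.
\<close>

definition tensor :: "('l::finite \<Rightarrow> real ^ 'n::finite) \<Rightarrow> real ^ ('l \<Rightarrow> 'n)" where
  "tensor x = (\<chi> a. \<Prod>i\<in>UNIV. x i $ a i)"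

definition tensor_space :: "('l::finite \<Rightarrow> 'n::finite set) \<Rightarrow> (real ^ ('l \<Rightarrow> 'n)) set" where
  "tensor_space J = coord_space {a. \<forall>i. a i \<in> J i}"

definition proj_tensor :: "('l::finite \<Rightarrow> (real ^ 'n::finite) set) \<Rightarrow> (real ^ ('l \<Rightarrow> 'n)) set" where
  "proj_tensor Q = convex hull {tensor x | x. \<forall>i. x i \<in> Q i}"

definition inj_tensor ::
  "('l::finite \<Rightarrow> 'n::finite set) \<Rightarrow> ('l \<Rightarrow> (real ^ 'n) set) \<Rightarrow> (real ^ ('l \<Rightarrow> 'n)) set" where
  "inj_tensor J Q =
     polar (tensor_space J) (proj_tensor (\<lambda>i. polar (coord_space (J i)) (Q i)))"

definition tensorial_bodies ::
  "('l::finite \<Rightarrow> 'n::finite set) \<Rightarrow> (real ^ ('l \<Rightarrow> 'n)) set set" where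
  "tensorial_bodies J =
     {Q. sym_convex_body (tensor_space J) Q \<and>
         (\<exists>R. (\<forall>i. sym_convex_body (coord_space (J i)) (R i)) \<and>
              proj_tensor R \<subseteq> Q \<and> Q \<subseteq> inj_tensor J R)}"

definition tensorial_bodies_topology ::
  "('l::finite \<Rightarrow> 'n::finite set) \<Rightarrow> (real ^ ('l \<Rightarrow> 'n)) set topology" where
  "tensorial_bodies_topology J =
     Metric_space.mtopology (tensorial_bodies J) (hausdorff_dist (tensor_space J))"


text \<open>The following facts confirm that the definitions above describe the intended objects.\<close>

lemma dim_coord_space:
  fixes S :: "'n::finite set"
  shows "dim (coord_space S) = card S"
proof -
  have *: "coord_space S = {x::real^'n. \<forall>i\<in>Basis. i \<notin> (\<lambda>j. axis j 1) ` S \<longrightarrow> x \<bullet> i = 0}"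
    by (auto simp: coord_space_def Basis_vec_def inner_axis axis_eq_axis image_iff)
  have "(\<lambda>j. axis j 1 :: real^'n) ` S \<subseteq> Basis"
    by (auto simp: Basis_vec_def)
  from dim_substandard[OF this] have "dim (coord_space S) = card ((\<lambda>j. axis j 1 :: real^'n) ` S)"
    unfolding * .
  also have "\<dots> = card S"
    by (rule card_image) (auto simp: inj_on_def axis_eq_axis)
  finally show ?thesis .
qed

lemma inner_tensor:
  fixes x y :: "'l::finite \<Rightarrow> real ^ 'n::finite"
  shows "tensor x \<bullet> tensor y = (\<Prod>i\<in>UNIV. x i \<bullet> y i)"
proof -
  have "(\<Prod>i\<in>UNIV. x i \<bullet> y i) = (\<Prod>i\<in>UNIV. \<Sum>j\<in>UNIV. x i $ j * y i $ j)"
    by (simp add: inner_vec_def)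
  also have "\<dots> = (\<Sum>a\<in>PiE UNIV (\<lambda>_. UNIV). \<Prod>i\<in>UNIV. x i $ a i * y i $ a i)"
    by (rule prod_sum_PiE) auto
  also have "\<dots> = tensor x \<bullet> tensor y"
    by (simp add: inner_vec_def tensor_def prod.distrib PiE_UNIV_domain)
  finally show ?thesis by simp
qed

lemma subspace_coord_space: "subspace (coord_space S)"
  by (auto simp: subspace_def coord_space_def)

lemma tensor_axis: "tensor (\<lambda>i. axis (a i) 1) = axis a 1"
  by (auto simp: tensor_def vec_eq_iff axis_def fun_eq_iff)

lemma span_tensors:
  "span {tensor x | x. \<forall>i. x i \<in> coord_space (J i)} = tensor_space J" (is "span ?T = _")
proof
  have "?T \<subseteq> tensor_space J"
    by (fastforce simp: tensor_def tensor_space_def coord_space_def intro!: prod_zero)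
  then show "span ?T \<subseteq> tensor_space J"
    unfolding tensor_space_def by (rule span_minimal[OF _ subspace_coord_space])
next
  show "tensor_space J \<subseteq> span ?T"
  proof
    fix z assume z: "z \<in> tensor_space J"
    have "z $ a *\<^sub>R axis a 1 \<in> span ?T" for a
    proof (cases "\<forall>i. a i \<in> J i")
      case True
      then have "\<forall>i. (axis (a i) 1 :: real^'b) \<in> coord_space (J i)"
        by (auto simp: coord_space_def axis_def)
      then have "axis a 1 \<in> ?T" using tensor_axis[of a] by (smt (verit) mem_Collect_eq)
      then show ?thesis by (simp add: span_base span_mul)
    next
      case False
      then show ?thesis using z by (simp add: tensor_space_def coord_space_def span_zero)
    qed
    then have "(\<Sum>a\<in>UNIV. z $ a *\<^sub>R axis a 1) \<in> span ?T" by (intro span_sum) auto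
    moreover have "(\<Sum>a\<in>UNIV. z $ a *\<^sub>R axis a 1) = z"
      by (simp add: vec_eq_iff axis_def if_distrib cong: if_cong)
    ultimately show "z \<in> span ?T" by simp
  qed
qed

lemma Metric_space_hausdorff_dist:
  fixes V :: "'a::euclidean_space set"
  assumes V: "subspace V"
  shows "Metric_space {Q. sym_convex_body V Q} (hausdorff_dist V)"
proof -
  define L where "L P Q = {r. 0 \<le> r \<and>
      (\<forall>p\<in>P. \<exists>q\<in>Q. \<exists>b\<in>V \<inter> cball 0 1. p = q + r *\<^sub>R b) \<and>
      (\<forall>q\<in>Q. \<exists>p\<in>P. \<exists>b\<in>V \<inter> cball 0 1. q = p + r *\<^sub>R b)}" for P Q :: "'a set"
  have hd: "hausdorff_dist V P Q = (if L P Q = {} then 0 else Inf (L P Q))" for P Q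
  proof -
    have "{r. 0 \<le> r \<and> P \<subseteq> {q + r *\<^sub>R b | q b. q \<in> Q \<and> b \<in> V \<inter> cball 0 1}
        \<and> Q \<subseteq> {p + r *\<^sub>R b | p b. p \<in> P \<and> b \<in> V \<inter> cball 0 1}} = L P Q"
      unfolding L_def by blast
    then show ?thesis unfolding hausdorff_dist_def Let_def by simp
  qed
  have ball: "(\<exists>b\<in>V \<inter> cball 0 1. p = q + r *\<^sub>R b) \<longleftrightarrow> dist p q \<le> r"
    if "p \<in> V" "q \<in> V" "0 \<le> r" for p q r
  proof
    assume "\<exists>b\<in>V \<inter> cball 0 1. p = q + r *\<^sub>R b"
    then show "dist p q \<le> r" using \<open>0 \<le> r\<close> by (auto simp: dist_norm mult_left_le)
  next
    assume d: "dist p q \<le> r"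
    show "\<exists>b\<in>V \<inter> cball 0 1. p = q + r *\<^sub>R b"
    proof (cases "r = 0")
      case True
      then show ?thesis using d subspace_0[OF V] by auto
    next
      case False
      then have "norm ((p - q) /\<^sub>R r) \<le> 1"
        using d \<open>0 \<le> r\<close> by (simp add: dist_norm divide_simps)
      then have "(p - q) /\<^sub>R r \<in> V \<inter> cball 0 1" "p = q + r *\<^sub>R ((p - q) /\<^sub>R r)"
        using that V False by (simp_all add: subspace_diff subspace_scale)
      then show ?thesis by blast
    qed
  qed
  have L: "L P Q = {r. 0 \<le> r \<and> (\<forall>p\<in>P. \<exists>q\<in>Q. dist p q \<le> r) \<and> (\<forall>q\<in>Q. \<exists>p\<in>P. dist q p \<le> r)}"
    if "P \<subseteq> V" "Q \<subseteq> V" for P Q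
    unfolding L_def using ball that by (intro Collect_cong) (meson subsetD)
  have nonneg: "0 \<le> r" if "r \<in> L P Q" for r P Q
    using that unfolding L_def by (simp only: mem_Collect_eq)
  have bdd: "bdd_below (L P Q)" for P Q
    using nonneg by (rule bdd_belowI)
  have body: "Q \<subseteq> V" "compact Q" "Q \<noteq> {}" if "sym_convex_body V Q" for Q
    using that interior_of_subset[of "top_of_set V" Q] by (auto simp: sym_convex_body_def)
  have ne: "L P Q \<noteq> {}" if bs: "sym_convex_body V P" "sym_convex_body V Q" for P Q
  proof -
    have ne: "P \<noteq> {}" "Q \<noteq> {}" and bounded: "bounded (P \<union> Q)"
      using body bs by (simp_all add: compact_imp_bounded)
    then have "dist x y \<le> diameter (P \<union> Q)" if "x \<in> P \<union> Q" "y \<in> P \<union> Q" for x y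
      using that by (simp add: diameter_bounded_bound)
    then have "\<forall>x\<in>P. \<exists>y\<in>Q. dist x y \<le> diameter (P \<union> Q)"
      "\<forall>y\<in>Q. \<exists>x\<in>P. dist y x \<le> diameter (P \<union> Q)"
      using ne by (meson UnI1 UnI2 all_not_in_conv)+
    then have "diameter (P \<union> Q) \<in> L P Q"
      using L[OF body(1)[OF bs(1)] body(1)[OF bs(2)]] diameter_ge_0[OF bounded] by simp
    then show ?thesis by blast
  qed
  have approx: "\<exists>r\<in>L P Q. r < hausdorff_dist V P Q + e"
    if "sym_convex_body V P" "sym_convex_body V Q" "e > 0" for P Q e
    using ne[OF that(1,2)] that(3) cInf_lessD[of "L P Q" "Inf (L P Q) + e"] by (auto simp: hd)
  have sub0: "P \<subseteq> Q"
    if bs: "sym_convex_body V P" "sym_convex_body V Q" and 0: "hausdorff_dist V P Q = 0" for P Q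
  proof
    fix p assume p: "p \<in> P"
    have "\<exists>q\<in>Q. dist q p < e" if e: "e > 0" for e
    proof -
      obtain r where r: "r \<in> L P Q" "r < e" using approx[OF bs e] 0 by auto
      then obtain q where "q \<in> Q" "dist p q \<le> r"
        using p L[OF body(1)[OF bs(1)] body(1)[OF bs(2)]] by blast
      then show ?thesis using r by (auto simp: dist_commute intro!: bexI[of _ q])
    qed
    then have "p \<in> closure Q" by (simp add: closure_approachable)
    then show "p \<in> Q" using body(2)[OF bs(2)] by (simp add: compact_imp_closed)
  qed
  have comm: "hausdorff_dist V P Q = hausdorff_dist V Q P" for P Q
  proof -
    have "L P Q = L Q P" unfolding L_def
      by (rule Collect_cong) (rule conj_cong[OF refl conj_commute])
    then show ?thesis by (simp add: hd)
  qed
  show ?thesis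
  proof
    show "0 \<le> hausdorff_dist V P Q" for P Q
      using cInf_greatest[of "L P Q" 0] nonneg by (simp add: hd)
    show "hausdorff_dist V P Q = hausdorff_dist V Q P" for P Q by (fact comm)
    show "hausdorff_dist V P Q = 0 \<longleftrightarrow> P = Q"
      if "P \<in> {Q. sym_convex_body V Q}" "Q \<in> {Q. sym_convex_body V Q}" for P Q
    proof
      assume "hausdorff_dist V P Q = 0"
      then show "P = Q" using sub0 comm that by (metis mem_Collect_eq subset_antisym)
    next
      assume "P = Q"
      moreover have "0 \<in> L Q Q" using L[of Q Q] body(1)[of Q] that by simp
      ultimately have "Inf (L P Q) \<le> 0" using cInf_lower bdd by metis
      moreover have "0 \<le> Inf (L P Q)"
        using \<open>0 \<in> L Q Q\<close> \<open>P = Q\<close> nonneg by (intro cInf_greatest) auto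
      ultimately show "hausdorff_dist V P Q = 0" by (simp add: hd)
    qed
    show "hausdorff_dist V P R \<le> hausdorff_dist V P Q + hausdorff_dist V Q R"
      if "P \<in> {Q. sym_convex_body V Q}" "Q \<in> {Q. sym_convex_body V Q}"
        "R \<in> {Q. sym_convex_body V Q}" for P Q R
    proof (rule field_le_epsilon)
      fix e :: real assume "e > 0"
      have bs: "sym_convex_body V P" "sym_convex_body V Q" "sym_convex_body V R"
        using that by auto
      obtain r s where r: "r \<in> L P Q" "r < hausdorff_dist V P Q + e/2"
        and s: "s \<in> L Q R" "s < hausdorff_dist V Q R + e/2"
        using approx[OF bs(1,2)] approx[OF bs(2,3)] \<open>e > 0\<close> by (meson half_gt_zero)
      have tri: "dist x z \<le> r + s" if "dist x y \<le> r" "dist y z \<le> s" for x y z :: 'a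
        using dist_triangle[of x z y] that by linarith
      have tri': "dist x z \<le> r + s" if "dist x y \<le> s" "dist y z \<le> r" for x y z :: 'a
        using dist_triangle[of x z y] that by linarith
      have r': "0 \<le> r" "\<forall>p\<in>P. \<exists>q\<in>Q. dist p q \<le> r" "\<forall>q\<in>Q. \<exists>p\<in>P. dist q p \<le> r"
        using r L[OF body(1)[OF bs(1)] body(1)[OF bs(2)]] by auto
      have s': "0 \<le> s" "\<forall>p\<in>Q. \<exists>q\<in>R. dist p q \<le> s" "\<forall>q\<in>R. \<exists>p\<in>Q. dist q p \<le> s"
        using s L[OF body(1)[OF bs(2)] body(1)[OF bs(3)]] by auto
      have "\<forall>p\<in>P. \<exists>q\<in>R. dist p q \<le> r + s" using r'(2) s'(2) tri by meson
      moreover have "\<forall>q\<in>R. \<exists>p\<in>P. dist q p \<le> r + s" using r'(3) s'(3) tri' by meson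
      ultimately have "r + s \<in> L P R" using L[OF body(1)[OF bs(1)] body(1)[OF bs(3)]] r'(1) s'(1) by simp
      then have "hausdorff_dist V P R \<le> r + s" using bdd cInf_lower by (auto simp: hd)
      then show "hausdorff_dist V P R \<le> hausdorff_dist V P Q + hausdorff_dist V Q R + e"
        using r s by linarith
    qed
  qed
qed

lemma topspace_tensorial_bodies [simp]:
  "topspace (tensorial_bodies_topology J) = tensorial_bodies J"
proof -
  have "subspace (tensor_space J)"
    by (simp add: tensor_space_def subspace_coord_space)
  then have "Metric_space (tensorial_bodies J) (hausdorff_dist (tensor_space J))"
    by (rule Metric_space.subspace[OF Metric_space_hausdorff_dist])
      (auto simp: tensorial_bodies_def)
  then show ?thesis
    by (simp add: tensorial_bodies_topology_def Metric_space.topspace_mtopology)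
qed

end

theory Submission
  imports Defs
begin

text \<open>
  The factors \<open>T Q\<close> of a tensorial body \<open>Q\<close> become unique once they are normalised, and they are then
  given by a formula in \<open>Q\<close> that is monotone and homogeneous. The set of bodies between the
  projective and the injective tensor product of \<open>T Q\<close> is convex, so the segment
  \<open>(1 - t) Q + t (proj_tensor (T Q))\<close> stays among the tensorial bodies. Replacing the factors by
  \<open>(1 - t) (T Q i) + t B\<close> then moves the projective tensor product of \<open>T Q\<close> to that of the unit balls.

  Continuity is immediate in multiplicative form: for convex bodies, closeness in the Hausdorff
  distance amounts to \<open>P \<subseteq> c Q\<close> and \<open>Q \<subseteq> c P\<close> with \<open>c\<close> near \<open>1\<close>, and all constructions involved are
  monotone and homogeneous.
\<close>

subsection \<open>Symmetric convex bodies and polarity\<close>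

text \<open>A ball around an interior point \<open>x\<close>, averaged with the point
  \<open>- x\<close>, becomes a ball around \<open>0\<close>. This trades nonempty relative interior
  for an inner radius, the form used in every later estimate.\<close>

lemma sym_convex_body_iff:
  fixes V :: "'a::euclidean_space set"
  assumes V: "subspace V"
  shows "sym_convex_body V Q \<longleftrightarrow> Q \<subseteq> V \<and> compact Q \<and> convex Q \<and> (\<forall>x\<in>Q. - x \<in> Q) \<and>
    (\<exists>r>0. \<forall>x\<in>V. norm x \<le> r \<longrightarrow> x \<in> Q)" (is "?L \<longleftrightarrow> ?R")
proof
  assume L: ?L
  then have Q: "Q \<subseteq> V" "compact Q" "convex Q" and sym: "Q = uminus ` Q"
    and int: "top_of_set V interior_of Q \<noteq> {}"
    by (auto simp: sym_convex_body_def)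
  have neg: "\<forall>x\<in>Q. - x \<in> Q" using sym by blast
  obtain x T where T: "openin (top_of_set V) T" "x \<in> T" "T \<subseteq> Q"
    using int unfolding interior_of_def by blast
  then obtain e where e: "e > 0" "\<And>y. y \<in> V \<Longrightarrow> dist y x < e \<Longrightarrow> y \<in> T"
    unfolding openin_euclidean_subtopology_iff by blast
  have "y \<in> Q" if y: "y \<in> V" "norm y \<le> e / 4" for y
  proof -
    \<comment> \<open>\<open>y\<close> is the midpoint of \<open>x + 2 y\<close> and
      \<open>- x\<close>. The radius \<open>e / 4\<close> keeps \<open>x + 2 y\<close> within
      \<open>e / 2\<close> of \<open>x\<close>, strictly inside the open neighbourhood.\<close>
    have "x + 2 *\<^sub>R y \<in> V" using y V T Q by (auto intro: subspace_add subspace_scale)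
    then have "x + 2 *\<^sub>R y \<in> Q" using e T y by (auto simp: dist_norm)
    moreover have "- x \<in> Q" using T neg by blast
    ultimately have "(1/2) *\<^sub>R (x + 2 *\<^sub>R y) + (1/2) *\<^sub>R (- x) \<in> Q"
      by (intro convexD[OF Q(3)]) auto
    then show ?thesis by (simp add: algebra_simps)
  qed
  then show ?R using Q neg e(1) by (auto intro!: exI[of _ "e/4"])
next
  assume R: ?R
  then obtain r where r: "r > 0" "\<And>x. x \<in> V \<Longrightarrow> norm x \<le> r \<Longrightarrow> x \<in> Q" by blast
  have "openin (top_of_set V) (V \<inter> ball 0 r)" by auto
  moreover have "V \<inter> ball 0 r \<subseteq> Q" using r by auto
  moreover have "0 \<in> V \<inter> ball 0 r" using r V by (auto simp: subspace_0)
  ultimately have "top_of_set V interior_of Q \<noteq> {}"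
    unfolding interior_of_def by blast
  moreover have "Q = uminus ` Q" using R by (force simp: image_iff)
  ultimately show ?L using R by (auto simp: sym_convex_body_def)
qed

lemma sym_convex_body_minus: "sym_convex_body V Q \<Longrightarrow> x \<in> Q \<Longrightarrow> - x \<in> Q"
  by (auto simp: sym_convex_body_def)

lemma sym_convex_body_0:
  assumes "subspace V" "sym_convex_body V Q"
  shows "0 \<in> Q"
  using assms by (force simp: sym_convex_body_iff subspace_0)

lemma sym_convex_body_shrink:
  assumes "subspace V" "sym_convex_body V Q" "x \<in> Q" "0 \<le> t" "t \<le> 1"
  shows "t *\<^sub>R x \<in> Q"
  using convexD[of Q x 0 t "1 - t"] sym_convex_body_0[OF assms(1,2)] assms
  by (auto simp: sym_convex_body_def)

lemma sym_convex_body_bound: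
  assumes "sym_convex_body V Q"
  obtains R where "R > 0" "\<And>x. x \<in> Q \<Longrightarrow> norm x \<le> R"
  using assms by (meson sym_convex_body_def compact_imp_bounded bounded_pos)

text \<open>\<open>q + v\<close> is \<open>1 + e\<close> times a convex combination of
  \<open>q\<close> and \<open>v / e\<close>, and \<open>v / e\<close> lies in the inner ball. An
  additive error thus becomes a multiplicative one.\<close>

lemma sym_convex_body_add_small:
  assumes V: "subspace V" and Q: "sym_convex_body V Q"
    and r: "\<And>x. x \<in> V \<Longrightarrow> norm x \<le> r \<Longrightarrow> x \<in> Q"
    and q: "q \<in> Q" and v: "v \<in> V" "norm v \<le> e * r" and e: "0 \<le> e"
  shows "(q + v) /\<^sub>R (1 + e) \<in> Q"
proof (cases "e = 0")
  case True
  then show ?thesis using q v by simp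
next
  case False
  then have "e > 0" using e by simp
  then have "v /\<^sub>R e \<in> Q"
    using v V by (intro r) (auto simp: subspace_scale field_simps)
  then have "(1 / (1 + e)) *\<^sub>R q + (e / (1 + e)) *\<^sub>R (v /\<^sub>R e) \<in> Q"
    using Q q \<open>e > 0\<close> by (intro convexD) (auto simp: sym_convex_body_def field_simps)
  moreover have "e * (inverse e * inverse (1 + e)) = inverse (1 + e)"
    using \<open>e > 0\<close> by simp
  ultimately show ?thesis by (simp add: algebra_simps divide_inverse)
qed

text \<open>A hyperplane separating \<open>x\<close> from \<open>Q\<close> yields, after projection
  to \<open>V\<close> and rescaling, an element of the polar that violates the bound at
  \<open>x\<close>.\<close>

lemma bipolar:
  fixes V :: "'a::euclidean_space set"
  assumes V: "subspace V" and Q: "sym_convex_body V Q" and x: "x \<in> V"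
    and le: "\<And>y. y \<in> polar V Q \<Longrightarrow> \<bar>x \<bullet> y\<bar> \<le> 1"
  shows "x \<in> Q"
proof (rule ccontr)
  assume "x \<notin> Q"
  moreover have "convex Q" "closed Q"
    using Q by (auto simp: sym_convex_body_def compact_imp_closed)
  ultimately obtain a b where ab: "a \<bullet> x < b" "\<And>q. q \<in> Q \<Longrightarrow> a \<bullet> q > b"
    using separating_hyperplane_closed_point by metis
  have b: "b < 0" using ab(2)[OF sym_convex_body_0[OF V Q]] by simp
  \<comment> \<open>The normal \<open>a\<close> may leave \<open>V\<close>; its component
    \<open>u\<close> lies in \<open>V\<close> and has the same inner products with all vectors of
    \<open>V\<close>.\<close>
  obtain u w where u: "u \<in> V" and w: "\<And>v. v \<in> V \<Longrightarrow> orthogonal w v" and a: "a = u + w"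
    using orthogonal_subspace_decomp_exists[of V a] V by (metis span_eq_iff)
  have inner: "v \<bullet> u = a \<bullet> v" if "v \<in> V" for v
    using w[OF that] a by (simp add: orthogonal_def inner_add_left inner_add_right inner_commute)
  have "\<bar>q \<bullet> (u /\<^sub>R (- b))\<bar> \<le> 1" if q: "q \<in> Q" for q
  proof -
    have "q \<in> V" using q Q by (auto simp: sym_convex_body_def)
    then have "\<bar>q \<bullet> u\<bar> \<le> - b"
      using ab(2)[OF q] ab(2)[OF sym_convex_body_minus[OF Q q]] by (simp add: inner abs_le_iff)
    then show ?thesis using b by (simp add: abs_mult field_simps)
  qed
  then have "u /\<^sub>R (- b) \<in> polar V Q"
    using u V by (auto simp: polar_def subspace_scale simp del: scaleR_minus_left)
  from le[OF this] show False
    using ab(1) b x by (simp add: inner abs_mult field_simps abs_le_iff)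
qed

text \<open>The functional \<open>e\<close> attains a positive maximum on the compact polar, at some
  \<open>y\<close>. Dividing \<open>e\<close> by this maximum puts it into \<open>Q\<close> by the
  bipolar theorem, and \<open>y\<close> certifies that it lies on the boundary.\<close>

lemma boundary_point_exists:
  fixes V :: "'a::euclidean_space set"
  assumes V: "subspace V" and Q: "sym_convex_body V Q" and e: "e \<in> V" "e \<noteq> 0"
  shows "\<exists>s>0. s *\<^sub>R e \<in> Q \<and> (\<exists>y\<in>polar V Q. (s *\<^sub>R e) \<bullet> y = 1)"
proof -
  obtain r where r: "r > 0" "\<And>x. x \<in> V \<Longrightarrow> norm x \<le> r \<Longrightarrow> x \<in> Q"
    using Q V by (auto simp: sym_convex_body_iff)
  \<comment> \<open>An inner radius \<open>r\<close> of \<open>Q\<close> bounds the polar by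
    \<open>1 / r\<close>: test \<open>y\<close> against its own multiple of norm
    \<open>r\<close>.\<close>
  have "norm y \<le> 1 / r" if y: "y \<in> polar V Q" for y
  proof (cases "y = 0")
    case False
    have "(r / norm y) *\<^sub>R y \<in> Q"
      using y r(1) False V by (intro r(2)) (auto simp: polar_def subspace_scale)
    then have "\<bar>((r / norm y) *\<^sub>R y) \<bullet> y\<bar> \<le> 1" using y by (auto simp: polar_def)
    then show ?thesis
      using r(1) False by (simp add: abs_mult dot_square_norm power2_eq_square field_simps)
  qed (use r in auto)
  then have "bounded (polar V Q)" by (auto simp: bounded_iff)
  moreover have "closed (polar V Q)"
  proof -
    have "polar V Q = V \<inter> (\<Inter>x\<in>Q. {y. \<bar>x \<bullet> y\<bar> \<le> 1})" by (auto simp: polar_def)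
    moreover have "closed V" using V by (rule closed_subspace)
    ultimately show ?thesis
      by (auto intro!: closed_Int closed_INT closed_Collect_le continuous_intros)
  qed
  ultimately have cpt: "compact (polar V Q)" by (simp add: compact_eq_bounded_closed)
  have ne: "polar V Q \<noteq> {}" using V by (auto simp: polar_def subspace_0 intro!: exI[of _ 0])
  obtain y where y: "y \<in> polar V Q" "\<And>z. z \<in> polar V Q \<Longrightarrow> e \<bullet> z \<le> e \<bullet> y"
    using continuous_attains_sup[OF cpt ne, of "\<lambda>z. e \<bullet> z"]
    by (fastforce intro: continuous_intros)
  have neg: "- z \<in> polar V Q" if "z \<in> polar V Q" for z
    using that V by (auto simp: polar_def subspace_neg)
  obtain R where R: "R > 0" "\<And>x. x \<in> Q \<Longrightarrow> norm x \<le> R"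
    using sym_convex_body_bound[OF Q] by blast
  \<comment> \<open>An outer radius \<open>R\<close> of \<open>Q\<close> puts the multiple of
    \<open>e\<close> of norm \<open>1 / R\<close> into the polar, so the maximum is
    positive.\<close>
  have pos: "0 < e \<bullet> y"
  proof -
    define z where "z = e /\<^sub>R (R * norm e)"
    have "\<bar>x \<bullet> z\<bar> \<le> 1" if "x \<in> Q" for x
    proof -
      have "\<bar>x \<bullet> z\<bar> \<le> norm x * norm z" by (rule Cauchy_Schwarz_ineq2)
      also have "\<dots> \<le> R * norm z" by (intro mult_right_mono R that) auto
      also have "\<dots> = 1" using R e by (simp add: z_def field_simps)
      finally show ?thesis .
    qed
    then have "z \<in> polar V Q" using e V by (auto simp: polar_def z_def subspace_scale)
    moreover have "e \<bullet> z > 0" using e R by (simp add: z_def)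
    ultimately show ?thesis using y(2) by fastforce
  qed
  have "(e /\<^sub>R (e \<bullet> y)) \<in> Q"
  proof (rule bipolar[OF V Q])
    show "e /\<^sub>R (e \<bullet> y) \<in> V" using e V by (simp add: subspace_scale)
    fix z assume z: "z \<in> polar V Q"
    have "\<bar>e \<bullet> z\<bar> \<le> e \<bullet> y" using y(2)[OF z] y(2)[OF neg[OF z]] by simp
    then show "\<bar>(e /\<^sub>R (e \<bullet> y)) \<bullet> z\<bar> \<le> 1" using pos by (simp add: abs_mult field_simps)
  qed
  then show ?thesis using y(1) pos by (intro exI[of _ "inverse (e \<bullet> y)"]) (auto intro!: bexI[of _ y])
qed

subsection \<open>Multiplicative closeness\<close>

text \<open>For \<open>c > 0\<close> this says that each set lies in \<open>c\<close> times the
  other. Dividing points, rather than scaling sets, lets the condition be checked point by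
  point.\<close>

definition near :: "real \<Rightarrow> 'a::real_vector set \<Rightarrow> 'a set \<Rightarrow> bool" where
  "near c A B \<longleftrightarrow> (\<forall>a\<in>A. a /\<^sub>R c \<in> B) \<and> (\<forall>b\<in>B. b /\<^sub>R c \<in> A)"

text \<open>Convergence is taken along a filter so that the time parameter and the body can vary
  jointly in the homotopies.\<close>

definition near_lim :: "'b filter \<Rightarrow> ('b \<Rightarrow> 'a::real_vector set) \<Rightarrow> 'a set \<Rightarrow> bool" where
  "near_lim F f A \<longleftrightarrow> (\<forall>c>1. \<forall>\<^sub>F x in F. near c (f x) A)"

lemma near_trans: "near b A B \<Longrightarrow> near c B C \<Longrightarrow> near (b * c) A C"
  unfolding near_def by (metis scaleR_scaleR inverse_mult_distrib mult.commute)

lemma near_lim_const: "near_lim F (\<lambda>_. A) A" if "subspace V" "sym_convex_body V A"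
  using that sym_convex_body_shrink[OF that]
  by (auto simp: near_lim_def near_def inverse_le_1_iff)

section \<open>Comparison of multiplicative closeness with the Hausdorff distance\<close>

lemma hausdorff_dist_le:
  fixes V :: "'a::euclidean_space set"
  assumes V: "subspace V" and PQ: "P \<subseteq> V" "Q \<subseteq> V" and r: "0 \<le> r"
    and P: "\<And>p. p \<in> P \<Longrightarrow> \<exists>q\<in>Q. dist p q \<le> r" and Q: "\<And>q. q \<in> Q \<Longrightarrow> \<exists>p\<in>P. dist q p \<le> r"
  shows "hausdorff_dist V P Q \<le> r"
proof -
  define L where "L = {r. 0 \<le> r \<and> P \<subseteq> {q + r *\<^sub>R b | q b. q \<in> Q \<and> b \<in> V \<inter> cball 0 1}
                        \<and> Q \<subseteq> {p + r *\<^sub>R b | p b. p \<in> P \<and> b \<in> V \<inter> cball 0 1}}"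
  \<comment> \<open>The vector \<open>b\<close> is the displacement divided by \<open>r\<close>, and
    it stays in the subspace \<open>V\<close>. For \<open>r = 0\<close> the two points coincide and
    \<open>b = 0\<close> serves.\<close>
  have *: "\<exists>b\<in>V \<inter> cball 0 1. x = y + r *\<^sub>R b" if "x \<in> V" "y \<in> V" "dist x y \<le> r" for x y
  proof (cases "r = 0")
    case True
    then show ?thesis using that subspace_0[OF V] by auto
  next
    case False
    then have "norm ((x - y) /\<^sub>R r) \<le> 1" using that r by (simp add: dist_norm divide_simps)
    then show ?thesis using that False V
      by (intro bexI[of _ "(x - y) /\<^sub>R r"]) (auto simp: subspace_scale subspace_diff)
  qed
  have "r \<in> L"
  proof -
    have "\<exists>q b. p = q + r *\<^sub>R b \<and> q \<in> Q \<and> b \<in> V \<inter> cball 0 1" if "p \<in> P" for p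
      using P[OF that] * PQ that by (meson subsetD)
    moreover have "\<exists>p b. q = p + r *\<^sub>R b \<and> p \<in> P \<and> b \<in> V \<inter> cball 0 1" if "q \<in> Q" for q
      using Q[OF that] * PQ that by (meson subsetD)
    ultimately show ?thesis unfolding L_def using r by blast
  qed
  moreover have "bdd_below L" by (rule bdd_belowI[of _ 0]) (simp add: L_def)
  ultimately show ?thesis
    unfolding hausdorff_dist_def Let_def L_def[symmetric] by (auto intro: cInf_lower)
qed

text \<open>Some admissible radius lies below \<open>e\<close>. Attainment of the infimum is avoided
  by assuming a strict inequality.\<close>

lemma hausdorff_dist_less:
  fixes V :: "'a::euclidean_space set"
  assumes V: "subspace V" and P: "sym_convex_body V P" and Q: "sym_convex_body V Q"
    and less: "hausdorff_dist V P Q < e"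
  shows "(\<forall>p\<in>P. \<exists>q\<in>Q. dist p q \<le> e) \<and> (\<forall>q\<in>Q. \<exists>p\<in>P. dist q p \<le> e)"
proof -
  define L where "L = {r. 0 \<le> r \<and> P \<subseteq> {q + r *\<^sub>R b | q b. q \<in> Q \<and> b \<in> V \<inter> cball 0 1}
                        \<and> Q \<subseteq> {p + r *\<^sub>R b | p b. p \<in> P \<and> b \<in> V \<inter> cball 0 1}}"
  obtain R S where R: "R > 0" "\<And>x. x \<in> P \<Longrightarrow> norm x \<le> R"
    and S: "S > 0" "\<And>x. x \<in> Q \<Longrightarrow> norm x \<le> S"
    using sym_convex_body_bound[OF P] sym_convex_body_bound[OF Q] by metis
  \<comment> \<open>\<open>t\<close> is an admissible radius, since every point of either body is
    \<open>0\<close> plus a vector of norm at most \<open>t\<close>. Hence \<open>L\<close> is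
    nonempty and the dummy value \<open>0\<close> of the distance does not occur.\<close>
  define t where "t = R + S"
  have t: "t > 0" "\<And>x. x \<in> P \<Longrightarrow> norm x \<le> t" "\<And>x. x \<in> Q \<Longrightarrow> norm x \<le> t"
    using R(1) S(1) R(2) S(2) by (auto simp: t_def add_increasing add_increasing2)
  have sub: "A \<subseteq> {q + t *\<^sub>R b | q b. q \<in> B \<and> b \<in> V \<inter> cball 0 1}"
    if "0 \<in> B" "A \<subseteq> V" "\<And>x. x \<in> A \<Longrightarrow> norm x \<le> t" for A B
  proof
    fix x assume x: "x \<in> A"
    have "x = 0 + t *\<^sub>R (x /\<^sub>R t)" "x /\<^sub>R t \<in> V \<inter> cball 0 1"
      using t(1) that(3)[OF x] x that(2) V by (auto simp: subspace_scale field_simps)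
    then show "x \<in> {q + t *\<^sub>R b | q b. q \<in> B \<and> b \<in> V \<inter> cball 0 1}" using that(1) by blast
  qed
  have "t \<in> L" unfolding L_def
    using sub[OF sym_convex_body_0[OF V Q] _ t(2)] sub[OF sym_convex_body_0[OF V P] _ t(3)] t(1) P Q
    by (auto simp: sym_convex_body_def)
  then have "L \<noteq> {}" by blast
  moreover have "hausdorff_dist V P Q = (if L = {} then 0 else Inf L)"
    unfolding hausdorff_dist_def Let_def L_def ..
  ultimately obtain r where r: "r \<in> L" "r < e"
    using less cInf_lessD[of L e] by auto
  have "\<exists>q\<in>B. dist p q \<le> e"
    if sub: "A \<subseteq> {q + r *\<^sub>R b | q b. q \<in> B \<and> b \<in> V \<inter> cball 0 1}" and p: "p \<in> A" for A B p
  proof -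
    obtain q b where qb: "p = q + r *\<^sub>R b" "q \<in> B" "norm b \<le> 1"
      using subsetD[OF sub p] by auto
    have "r * norm b \<le> r" using r qb by (simp add: L_def mult_left_le)
    then have "dist p q \<le> e" using r qb by (auto simp: L_def dist_norm)
    then show ?thesis using qb by blast
  qed
  then show ?thesis using r(1) unfolding L_def by blast
qed

text \<open>The threshold involves an inner radius of \<open>Q\<close> only, so it is uniform over
  all \<open>P\<close> close to a fixed \<open>Q\<close>. The error \<open>e * r\<close> is then a
  vector of \<open>e Q\<close>, absorbed by rescaling.\<close>

lemma near_of_hausdorff:
  fixes V :: "'a::euclidean_space set"
  assumes V: "subspace V" and P: "sym_convex_body V P" and Q: "sym_convex_body V Q"
    and r: "r > 0" "\<And>x. x \<in> V \<Longrightarrow> norm x \<le> r \<Longrightarrow> x \<in> Q" and c: "c > 1"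
    and less: "hausdorff_dist V P Q < (1 - 1 / c) * r"
  shows "near c P Q"
proof -
  define e where "e = 1 - 1 / c"
  have e: "0 < e" "e < 1" "1 - e = inverse c" using c by (auto simp: e_def inverse_eq_divide)
  have PQ: "P \<subseteq> V" "Q \<subseteq> V" using P Q by (auto simp: sym_convex_body_def)
  note d = hausdorff_dist_less[OF V P Q less, folded e_def]
  have "p /\<^sub>R c \<in> Q" if p: "p \<in> P" for p
  proof -
    obtain q where q: "q \<in> Q" "dist p q \<le> e * r" using d p by blast
    have "(q + (p - q)) /\<^sub>R (1 + e) \<in> Q"
      using q p PQ e V
      by (intro sym_convex_body_add_small[OF V Q r(2)]) (auto simp: dist_norm intro: subspace_diff)
    then have "((1 + e) / c) *\<^sub>R ((q + (p - q)) /\<^sub>R (1 + e)) \<in> Q"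
    proof (rule sym_convex_body_shrink[OF V Q])
      \<comment> \<open>With \<open>e = 1 - 1 / c\<close>, the inequality
        \<open>1 + e \<le> c\<close> amounts to \<open>2 c \<le> c * c + 1\<close>.\<close>
      have "2 * c \<le> c * c + 1" using sum_squares_bound[of c 1] by (simp add: power2_eq_square)
      then have "1 + e \<le> c" using c by (simp add: e_def field_simps)
      then show "(1 + e) / c \<le> 1" using c by simp
    qed (use e c in auto)
    moreover have "(1 + e) / c * inverse (1 + e) = inverse c" using e c by (simp add: field_simps)
    ultimately show ?thesis by simp
  qed
  \<comment> \<open>\<open>Q \<subseteq> P + e Q\<close> gives \<open>(1 - e) Q \<subseteq> P\<close> by comparing maxima of linear functionals.\<close>
  moreover have "q /\<^sub>R c \<in> P" if q: "q \<in> Q" for q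
  proof (rule bipolar[OF V P])
    show "q /\<^sub>R c \<in> V" using q PQ V by (auto simp: subspace_scale)
    fix y assume y: "y \<in> polar V P"
    have "compact Q" "Q \<noteq> {}" using Q q by (auto simp: sym_convex_body_def)
    then obtain q1 where q1: "q1 \<in> Q" "\<And>z. z \<in> Q \<Longrightarrow> z \<bullet> y \<le> q1 \<bullet> y"
      using continuous_attains_sup[of Q "\<lambda>z. z \<bullet> y"]
      by (fastforce intro: continuous_intros)
    obtain p where p: "p \<in> P" "dist q1 p \<le> e * r" using d q1 by blast
    have "norm ((q1 - p) /\<^sub>R e) \<le> r"
      using p(2) e by (simp add: dist_norm divide_simps mult.commute)
    moreover have "(q1 - p) /\<^sub>R e \<in> V"
      using p(1) q1(1) PQ V by (auto intro!: subspace_scale subspace_diff)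
    ultimately have "(q1 - p) /\<^sub>R e \<in> Q" by (intro r(2))
    \<comment> \<open>On \<open>e Q\<close> the functional \<open>y\<close> is at most
      \<open>e\<close> times its maximum over \<open>Q\<close>, which \<open>q1\<close>
      attains.\<close>
    then have "(q1 - p) \<bullet> y \<le> e * (q1 \<bullet> y)" 
      using q1(2)[of "(q1 - p) /\<^sub>R e"] e(1) by (simp add: inverse_eq_divide pos_divide_le_eq mult.commute)
    moreover have "p \<bullet> y \<le> 1" using y p by (auto simp: polar_def abs_le_iff)
    ultimately have "(1 - e) * (q1 \<bullet> y) \<le> 1" by (simp add: inner_diff_left algebra_simps)
    moreover have "\<bar>q \<bullet> y\<bar> \<le> q1 \<bullet> y"
      using q1(2)[OF q] q1(2)[OF sym_convex_body_minus[OF Q q]] by (simp add: abs_le_iff)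
    ultimately have "(1 - e) * \<bar>q \<bullet> y\<bar> \<le> 1"
      using e by (smt (verit) mult_left_mono)
    then show "\<bar>(q /\<^sub>R c) \<bullet> y\<bar> \<le> 1" using c by (simp add: e(3) abs_mult)
  qed
  ultimately show ?thesis by (auto simp: near_def)
qed

text \<open>Each point is matched with its multiple by \<open>1 / c\<close>. The displacement of
  \<open>p\<close> is \<open>c - 1\<close> times \<open>p / c\<close>, a point of \<open>Q\<close>,
  so an outer radius of \<open>Q\<close> suffices for both directions.\<close>

lemma hausdorff_of_near:
  fixes V :: "'a::euclidean_space set"
  assumes V: "subspace V" and P: "P \<subseteq> V" and Q: "Q \<subseteq> V"
    and R: "\<And>x. x \<in> Q \<Longrightarrow> norm x \<le> R" "R > 0" and c: "c > 1" and near: "near c P Q"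
  shows "hausdorff_dist V P Q \<le> (c - 1) * R"
proof (rule hausdorff_dist_le[OF V P Q])
  show "0 \<le> (c - 1) * R" using R c by simp
  fix p assume "p \<in> P"
  then have q: "p /\<^sub>R c \<in> Q" using near by (auto simp: near_def)
  have "p - p /\<^sub>R c = (c - 1) *\<^sub>R (p /\<^sub>R c)" using c by (simp add: algebra_simps)
  then have "dist p (p /\<^sub>R c) = (c - 1) * norm (p /\<^sub>R c)" using c by (simp add: dist_norm)
  also have "\<dots> \<le> (c - 1) * R" using R(1)[OF q] c by (intro mult_left_mono) auto
  finally show "\<exists>q\<in>Q. dist p q \<le> (c - 1) * R" using q by blast
next
  fix q assume q: "q \<in> Q"
  then have p: "q /\<^sub>R c \<in> P" using near by (auto simp: near_def)
  have "q - q /\<^sub>R c = (1 - inverse c) *\<^sub>R q" by (simp add: algebra_simps)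
  moreover have "\<bar>1 - inverse c\<bar> = 1 - inverse c" using c by (simp add: inverse_le_1_iff)
  ultimately have "dist q (q /\<^sub>R c) = (1 - inverse c) * norm q" by (simp add: dist_norm)
  also have "\<dots> \<le> (c - 1) * R"
  proof (rule mult_mono)
    have "2 * c \<le> c * c + 1" using sum_squares_bound[of c 1] by (simp add: power2_eq_square)
    then show "1 - inverse c \<le> c - 1" using c by (simp add: field_simps)
  qed (use R(1)[OF q] c in auto)
  finally show "\<exists>p\<in>P. dist q p \<le> (c - 1) * R" using p by blast
qed

text \<open>Both preceding estimates use radii of the limit \<open>Q\<close> alone, so they hold
  uniformly along the filter.\<close>

lemma near_lim_iff_hausdorff:
  fixes V :: "'a::euclidean_space set"
  assumes V: "subspace V" and Q: "sym_convex_body V Q"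
    and f: "\<forall>\<^sub>F x in F. sym_convex_body V (f x)"
  shows "near_lim F f Q \<longleftrightarrow> (\<forall>e>0. \<forall>\<^sub>F x in F. hausdorff_dist V (f x) Q < e)"
proof
  assume L: "near_lim F f Q"
  obtain R where R: "R > 0" "\<And>x. x \<in> Q \<Longrightarrow> norm x \<le> R"
    using sym_convex_body_bound[OF Q] by blast
  show "\<forall>e>0. \<forall>\<^sub>F x in F. hausdorff_dist V (f x) Q < e"
  proof (intro allI impI)
    fix e :: real assume e: "e > 0"
    \<comment> \<open>This choice makes \<open>(c - 1) * R\<close> equal to
      \<open>e / 2\<close>.\<close>
    define c where "c = 1 + e / (2 * R)"
    have c: "c > 1" using e R by (simp add: c_def)
    have "\<forall>\<^sub>F x in F. near c (f x) Q" using L c by (auto simp: near_lim_def)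
    then show "\<forall>\<^sub>F x in F. hausdorff_dist V (f x) Q < e" using f
    proof eventually_elim
      case (elim x)
      have "hausdorff_dist V (f x) Q \<le> (c - 1) * R"
        using elim Q R c by (intro hausdorff_of_near[OF V]) (auto simp: sym_convex_body_def)
      also have "\<dots> < e" using e R by (simp add: c_def)
      finally show ?case .
    qed
  qed
next
  assume R: "\<forall>e>0. \<forall>\<^sub>F x in F. hausdorff_dist V (f x) Q < e"
  obtain r where r: "r > 0" "\<And>x. x \<in> V \<Longrightarrow> norm x \<le> r \<Longrightarrow> x \<in> Q"
    using Q V by (auto simp: sym_convex_body_iff)
  show "near_lim F f Q" unfolding near_lim_def
  proof (intro allI impI)
    fix c :: real assume c: "c > 1"
    then have "(1 - 1 / c) * r > 0" using r by simp
    then have "\<forall>\<^sub>F x in F. hausdorff_dist V (f x) Q < (1 - 1 / c) * r" using R by blast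
    then show "\<forall>\<^sub>F x in F. near c (f x) Q" using f
      by eventually_elim (rule near_of_hausdorff[OF V _ Q r c])
  qed
qed

section \<open>Minkowski combinations and their continuity\<close>

definition minkowski_comb :: "real \<Rightarrow> 'a::real_vector set \<Rightarrow> 'a set \<Rightarrow> 'a set" where
  "minkowski_comb t A B = {(1 - t) *\<^sub>R a + t *\<^sub>R b | a b. a \<in> A \<and> b \<in> B}"

lemma minkowski_comb_0: "B \<noteq> {} \<Longrightarrow> minkowski_comb 0 A B = A"
  and minkowski_comb_1: "A \<noteq> {} \<Longrightarrow> minkowski_comb 1 A B = B"
  by (auto simp: minkowski_comb_def)

text \<open>A common point is a combination of itself with itself. This supplies inner balls, and it
  keeps the projective product inside the segment of bodies.\<close>

lemma minkowski_comb_self: "A \<inter> B \<subseteq> minkowski_comb t A B"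
proof
  fix x assume "x \<in> A \<inter> B"
  then show "x \<in> minkowski_comb t A B"
    unfolding minkowski_comb_def by (intro CollectI exI[of _ x]) (simp add: algebra_simps)
qed

lemma minkowski_comb_subset: "convex C \<Longrightarrow> A \<subseteq> C \<Longrightarrow> B \<subseteq> C \<Longrightarrow> 0 \<le> t \<Longrightarrow> t \<le> 1 \<Longrightarrow> minkowski_comb t A B \<subseteq> C"
  by (auto simp: minkowski_comb_def intro!: convexD)

text \<open>The combination is a linear image of \<open>A \<times> B\<close>, which gives
  compactness and convexity; the inner ball comes from the intersection.\<close>

lemma sym_convex_body_minkowski_comb:
  fixes V :: "'a::euclidean_space set"
  assumes V: "subspace V" and A: "sym_convex_body V A" and B: "sym_convex_body V B"
    and t: "0 \<le> t" "t \<le> 1"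
  shows "sym_convex_body V (minkowski_comb t A B)"
  unfolding sym_convex_body_iff[OF V]
proof (intro conjI ballI)
  have A': "A \<subseteq> V" "compact A" "convex A" and B': "B \<subseteq> V" "compact B" "convex B"
    using A B by (auto simp: sym_convex_body_def)
  show "minkowski_comb t A B \<subseteq> V"
    using A' B' t subspace_imp_convex[OF V] by (intro minkowski_comb_subset)
  have eq: "minkowski_comb t A B = (\<lambda>z. (1 - t) *\<^sub>R fst z + t *\<^sub>R snd z) ` (A \<times> B)"
    by (force simp: minkowski_comb_def)
  show "compact (minkowski_comb t A B)" unfolding eq
    using A' B' by (intro compact_continuous_image compact_Times continuous_intros)
  have "linear (\<lambda>z. (1 - t) *\<^sub>R fst z + t *\<^sub>R snd z)"
    by (intro linearI) (auto simp: algebra_simps)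
  then show "convex (minkowski_comb t A B)" unfolding eq
    using A' B' by (intro convex_linear_image convex_Times)
  show "- x \<in> minkowski_comb t A B" if "x \<in> minkowski_comb t A B" for x
  proof -
    obtain a b where ab: "x = (1 - t) *\<^sub>R a + t *\<^sub>R b" "a \<in> A" "b \<in> B"
      using \<open>x \<in> minkowski_comb t A B\<close> by (auto simp: minkowski_comb_def)
    then have "- a \<in> A" "- b \<in> B" "- x = (1 - t) *\<^sub>R (- a) + t *\<^sub>R (- b)"
      using sym_convex_body_minus[OF A] sym_convex_body_minus[OF B] by auto
    then show ?thesis unfolding minkowski_comb_def by blast
  qed
  obtain r s where "r > 0" "\<And>x. x \<in> V \<Longrightarrow> norm x \<le> r \<Longrightarrow> x \<in> A"
    and "s > 0" "\<And>x. x \<in> V \<Longrightarrow> norm x \<le> s \<Longrightarrow> x \<in> B"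
    using A B V by (auto simp: sym_convex_body_iff)
  then show "\<exists>r>0. \<forall>x\<in>V. norm x \<le> r \<longrightarrow> x \<in> minkowski_comb t A B"
    using minkowski_comb_self[of A B t] by (intro exI[of _ "min r s"]) auto
qed

lemma near_minkowski_comb: "near c A A' \<Longrightarrow> near c B B' \<Longrightarrow> near c (minkowski_comb t A B) (minkowski_comb t A' B')"
proof -
  have *: "z /\<^sub>R c \<in> minkowski_comb t A' B'"
    if A: "\<forall>a\<in>A. a /\<^sub>R c \<in> A'" and B: "\<forall>b\<in>B. b /\<^sub>R c \<in> B'" and z: "z \<in> minkowski_comb t A B"
    for A B A' B' :: "'a set" and z
  proof -
    obtain a b where "z = (1 - t) *\<^sub>R a + t *\<^sub>R b" "a \<in> A" "b \<in> B"
      using z by (auto simp: minkowski_comb_def)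
    then have "z /\<^sub>R c = (1 - t) *\<^sub>R (a /\<^sub>R c) + t *\<^sub>R (b /\<^sub>R c)" "a /\<^sub>R c \<in> A'" "b /\<^sub>R c \<in> B'"
      using A B by (simp_all add: scaleR_add_right mult.commute)
    then show ?thesis unfolding minkowski_comb_def by blast
  qed
  assume "near c A A'" "near c B B'"
  then show ?thesis using *[of A A' B B'] *[of A' A B' B] by (simp add: near_def)
qed

text \<open>The error splits into two factors \<open>sqrt c\<close>: one for replacing the bodies at
  a fixed parameter, one for moving the parameter with the limit bodies fixed.\<close>

lemma near_lim_minkowski_comb:
  fixes V :: "'a::euclidean_space set"
  assumes V: "subspace V" and A: "sym_convex_body V A" and B: "sym_convex_body V B"
    and t: "(t \<longlongrightarrow> t0) F" "\<forall>\<^sub>F x in F. 0 \<le> t x \<and> t x \<le> 1" "0 \<le> t0" "t0 \<le> 1"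
    and f: "near_lim F f A" and g: "near_lim F g B"
  shows "near_lim F (\<lambda>x. minkowski_comb (t x) (f x) (g x)) (minkowski_comb t0 A B)"
  unfolding near_lim_def
proof (intro allI impI)
  fix c :: real assume c: "c > 1"
  define s where "s = sqrt c"
  have s: "s > 1" "s * s = c" using c by (auto simp: s_def)
  obtain r1 r2 where r1: "r1 > 0" "\<And>x. x \<in> V \<Longrightarrow> norm x \<le> r1 \<Longrightarrow> x \<in> A"
    and r2: "r2 > 0" "\<And>x. x \<in> V \<Longrightarrow> norm x \<le> r2 \<Longrightarrow> x \<in> B"
    using A B V by (auto simp: sym_convex_body_iff)
  \<comment> \<open>The ball of radius \<open>r\<close> lies in both bodies, hence in every
    combination, so one radius serves all parameters.\<close>
  define r where "r = min r1 r2"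
  have r: "r > 0" "x \<in> V \<Longrightarrow> norm x \<le> r \<Longrightarrow> x \<in> minkowski_comb u A B" for x u
    using r1 r2 minkowski_comb_self[of A B u] by (auto simp: r_def)
  obtain R1 R2 where R1: "R1 > 0" "\<And>x. x \<in> A \<Longrightarrow> norm x \<le> R1"
    and R2: "R2 > 0" "\<And>x. x \<in> B \<Longrightarrow> norm x \<le> R2"
    using sym_convex_body_bound[OF A] sym_convex_body_bound[OF B] by metis
  define R where "R = R1 + R2"
  have R: "R > 0" using R1 R2 by (simp add: R_def)
  have AB: "A \<subseteq> V" "B \<subseteq> V" using A B by (auto simp: sym_convex_body_def)
  \<comment> \<open>Passing from \<open>u\<close> to \<open>v\<close> displaces a point by
    \<open>(u - v) (b - a)\<close>, a vector of \<open>V\<close> small enough to be absorbed by the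
    common inner ball.\<close>
  have move: "x /\<^sub>R s \<in> minkowski_comb v A B"
    if uv: "0 \<le> v" "v \<le> 1" "\<bar>u - v\<bar> * R \<le> (s - 1) * r" and x: "x \<in> minkowski_comb u A B" for u v x
  proof -
    obtain a b where ab: "x = (1 - u) *\<^sub>R a + u *\<^sub>R b" "a \<in> A" "b \<in> B"
      using x by (auto simp: minkowski_comb_def)
    have "norm (b - a) \<le> R"
      using norm_triangle_ineq4[of b a] R1(2)[OF ab(2)] R2(2)[OF ab(3)] by (simp add: R_def)
    then have "norm ((u - v) *\<^sub>R (b - a)) \<le> (s - 1) * r"
      using mult_left_mono[of "norm (b - a)" R "\<bar>u - v\<bar>"] uv(3) by simp
    moreover have "(u - v) *\<^sub>R (b - a) \<in> V"
      using ab AB V by (auto intro!: subspace_scale subspace_diff)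
    moreover have "(1 - v) *\<^sub>R a + v *\<^sub>R b \<in> minkowski_comb v A B" using ab by (auto simp: minkowski_comb_def)
    ultimately have "((1 - v) *\<^sub>R a + v *\<^sub>R b + (u - v) *\<^sub>R (b - a)) /\<^sub>R (1 + (s - 1)) \<in> minkowski_comb v A B"
      using s by (intro sym_convex_body_add_small[OF V sym_convex_body_minkowski_comb[OF V A B uv(1,2)] r(2)]) auto
    moreover have "(1 - v) *\<^sub>R a + v *\<^sub>R b + (u - v) *\<^sub>R (b - a) = x"
      by (simp add: ab(1) algebra_simps)
    ultimately show ?thesis by simp
  qed
  have "(s - 1) * r / R > 0" using s r R by simp
  then have "\<forall>\<^sub>F x in F. dist (t x) t0 < (s - 1) * r / R" using t(1) tendstoD by blast
  moreover have "\<forall>\<^sub>F x in F. near s (f x) A" "\<forall>\<^sub>F x in F. near s (g x) B"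
    using f g s by (auto simp: near_lim_def)
  ultimately show "\<forall>\<^sub>F x in F. near c (minkowski_comb (t x) (f x) (g x)) (minkowski_comb t0 A B)" using t(2)
  proof eventually_elim
    case (elim x)
    have "\<bar>t x - t0\<bar> * R \<le> (s - 1) * r" using elim(1) R by (simp add: dist_real_def field_simps)
    then have "near s (minkowski_comb (t x) A B) (minkowski_comb t0 A B)"
      using move elim(4) t(3,4) unfolding near_def by (simp add: abs_minus_commute)
    from near_trans[OF near_minkowski_comb[OF elim(2,3)] this] show ?case using s by simp
  qed
qed

subsection \<open>Tensor products of convex bodies\<close>

lemma subspace_tensor_space: "subspace (tensor_space J)"
  by (simp add: tensor_space_def subspace_coord_space)

lemma tensor_in_tensor_space: "(\<And>i. x i \<in> coord_space (J i)) \<Longrightarrow> tensor x \<in> tensor_space J"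
  using span_tensors[of J] by (auto intro!: span_base)

lemma tensor_scaleR: "tensor (\<lambda>i. c i *\<^sub>R x i) = (\<Prod>i\<in>UNIV. c i) *\<^sub>R tensor x"
  by (simp add: tensor_def vec_eq_iff prod.distrib)

lemma tensor_scaleR_upd: "tensor (x(i := c *\<^sub>R v)) = c *\<^sub>R tensor (x(i := v))"
proof -
  have "tensor (x(i := c *\<^sub>R v)) = tensor (\<lambda>j. (if j = i then c else 1) *\<^sub>R (x(i := v)) j)"
    by (rule arg_cong[of _ _ tensor]) auto
  also have "\<dots> = (\<Prod>j\<in>UNIV. if j = i then c else 1) *\<^sub>R tensor (x(i := v))"
    by (rule tensor_scaleR)
  finally show ?thesis by simp
qed

lemma tensor_in_proj_tensor: "(\<And>i. x i \<in> R i) \<Longrightarrow> tensor x \<in> proj_tensor R"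
  unfolding proj_tensor_def by (rule hull_inc) blast

lemma proj_tensor_subset:
  "convex C \<Longrightarrow> (\<And>x. (\<And>i. x i \<in> R i) \<Longrightarrow> tensor x \<in> C) \<Longrightarrow> proj_tensor R \<subseteq> C"
  unfolding proj_tensor_def by (rule hull_minimal) blast+

text \<open>Elementary tensors suffice as test vectors, because the slab of all \<open>w\<close>
  with \<open>\<bar>w \<bullet> z\<bar> \<le> 1\<close> is convex.\<close>

lemma in_inj_tensor_iff:
  "z \<in> inj_tensor J R \<longleftrightarrow> z \<in> tensor_space J \<and>
     (\<forall>y. (\<forall>i. y i \<in> polar (coord_space (J i)) (R i)) \<longrightarrow> \<bar>tensor y \<bullet> z\<bar> \<le> 1)" (is "_ \<longleftrightarrow> ?R")
proof
  assume "z \<in> inj_tensor J R"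
  then show ?R by (auto simp: inj_tensor_def polar_def[of "tensor_space J"] intro: tensor_in_proj_tensor)
next
  assume R: ?R
  have "{w. \<bar>w \<bullet> z\<bar> \<le> 1} = {w. z \<bullet> w \<le> 1} \<inter> {w. z \<bullet> w \<ge> - 1}"
    by (auto simp: inner_commute)
  then have "convex {w. \<bar>w \<bullet> z\<bar> \<le> 1}"
    by (simp add: convex_Int convex_halfspace_le convex_halfspace_ge)
  then have "proj_tensor (\<lambda>i. polar (coord_space (J i)) (R i)) \<subseteq> {w. \<bar>w \<bullet> z\<bar> \<le> 1}"
    using R by (intro proj_tensor_subset) auto
  then show "z \<in> inj_tensor J R" using R
    unfolding inj_tensor_def polar_def[of "tensor_space J"] by blast
qed

lemma convex_inj_tensor: "convex (inj_tensor J R)"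
proof (rule convexI)
  fix x y and u v :: real
  assume xy: "x \<in> inj_tensor J R" "y \<in> inj_tensor J R" and uv: "0 \<le> u" "0 \<le> v" "u + v = 1"
  have "\<bar>w \<bullet> (u *\<^sub>R x + v *\<^sub>R y)\<bar> \<le> 1" if "\<bar>w \<bullet> x\<bar> \<le> 1" "\<bar>w \<bullet> y\<bar> \<le> 1" for w
  proof -
    have "u * \<bar>w \<bullet> x\<bar> + v * \<bar>w \<bullet> y\<bar> \<le> 1" using that uv by (intro convex_bound_le)
    then show ?thesis
      using abs_triangle_ineq[of "u * (w \<bullet> x)" "v * (w \<bullet> y)"] uv
      by (simp add: inner_add_right abs_mult)
  qed
  then show "u *\<^sub>R x + v *\<^sub>R y \<in> inj_tensor J R"
    using xy by (auto simp: in_inj_tensor_iff intro!: subspace_add subspace_scale subspace_tensor_space)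
qed

text \<open>The inner product of two elementary tensors factorises, and each factor is at most
  \<open>1\<close> in absolute value.\<close>

lemma proj_tensor_subset_inj_tensor:
  assumes "\<And>i. R i \<subseteq> coord_space (J i)"
  shows "proj_tensor R \<subseteq> inj_tensor J R"
proof (rule proj_tensor_subset[OF convex_inj_tensor])
  fix x assume x: "\<And>i. x i \<in> R i"
  have "\<bar>tensor y \<bullet> tensor x\<bar> \<le> 1" if y: "\<And>i. y i \<in> polar (coord_space (J i)) (R i)" for y
    using x y by (auto simp: inner_tensor abs_prod inner_commute polar_def intro!: prod_le_1)
  then show "tensor x \<in> inj_tensor J R"
    using x assms by (auto simp: in_inj_tensor_iff intro!: tensor_in_tensor_space)
qed

lemma convex_sym_scaleR:
  assumes "convex S" "x \<in> S" "- x \<in> S" "\<bar>t\<bar> \<le> 1"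
  shows "t *\<^sub>R x \<in> S"
proof -
  have "((1 + t) / 2) *\<^sub>R x + ((1 - t) / 2) *\<^sub>R (- x) \<in> S"
    using assms by (intro convexD) (auto simp: field_simps)
  then show ?thesis by (simp flip: scaleR_left_diff_distrib add: field_simps)
qed

text \<open>Compactness: \<open>tensor\<close> is continuous on a compact product, and in finite
  dimension the convex hull of a compact set is compact. The inner ball is found from the coordinate
  tensors.\<close>

lemma sym_convex_body_proj_tensor:
  fixes R :: "'l::finite \<Rightarrow> (real ^ 'n::finite) set"
  assumes R: "\<And>i. sym_convex_body (coord_space (J i)) (R i)"
  shows "sym_convex_body (tensor_space J) (proj_tensor R)"
  unfolding sym_convex_body_iff[OF subspace_tensor_space]
proof (intro conjI)
  have R': "R i \<subseteq> coord_space (J i)" "compact (R i)" for i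
    using R by (auto simp: sym_convex_body_def)
  show conv: "convex (proj_tensor R)" by (simp add: proj_tensor_def)
  show "proj_tensor R \<subseteq> tensor_space J"
    using R' by (intro proj_tensor_subset tensor_in_tensor_space)
      (auto simp: subspace_imp_convex subspace_tensor_space)
  have "compact (PiE UNIV R)"
    using R' compactin_PiE[of "\<lambda>_. euclidean" UNIV R] by (simp add: euclidean_product_topology)
  moreover have "continuous_on UNIV (\<lambda>x. tensor x :: real ^ ('l \<Rightarrow> 'n))"
    unfolding tensor_def by (intro continuous_intros continuous_on_product_coordinates)
  ultimately have "compact (tensor ` PiE UNIV R)"
    using compact_continuous_image continuous_on_subset by blast
  moreover have "tensor ` PiE UNIV R = {tensor x | x. \<forall>i. x i \<in> R i}" by auto
  ultimately show "compact (proj_tensor R)" by (simp add: proj_tensor_def compact_convex_hull)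
  have "proj_tensor R \<subseteq> uminus ` proj_tensor R"
  proof (rule proj_tensor_subset)
    show "convex (uminus ` proj_tensor R)" using conv by (rule convex_negations)
    fix x assume x: "\<And>i. x i \<in> R i"
    \<comment> \<open>Any slot will do: negating one factor negates the tensor.\<close>
    fix j :: 'l
    have "tensor (x(j := (- 1) *\<^sub>R x j)) \<in> proj_tensor R"
      using x sym_convex_body_minus[OF R] by (intro tensor_in_proj_tensor) auto
    then have "- tensor x \<in> proj_tensor R" unfolding tensor_scaleR_upd by simp
    then show "tensor x \<in> uminus ` proj_tensor R" by (metis imageI minus_minus)
  qed
  then show neg: "\<forall>z\<in>proj_tensor R. - z \<in> proj_tensor R" by force
  obtain r where r: "\<And>i. r i > 0"
    "\<And>i x. x \<in> coord_space (J i) \<Longrightarrow> norm x \<le> r i \<Longrightarrow> x \<in> R i"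
    using R unfolding sym_convex_body_iff[OF subspace_coord_space] by metis
  define p where "p = (\<Prod>i\<in>UNIV. r i)"
  \<comment> \<open>\<open>z\<close> will be written as the average of the \<open>N\<close> vectors
    \<open>N * z $ a\<close> times \<open>axis a 1\<close>. All multi-indices are counted; those
    outside \<open>J\<close> contribute the zero vector.\<close>
  define N where "N = real CARD('l \<Rightarrow> 'n)"
  have p: "p > 0" and N: "N > 0" using r by (auto simp: p_def N_def prod_pos)
  show "\<exists>r>0. \<forall>z\<in>tensor_space J. norm z \<le> r \<longrightarrow> z \<in> proj_tensor R"
  proof (intro exI[of _ "p / N"] conjI ballI impI)
    fix z assume z: "z \<in> tensor_space J" "norm z \<le> p / N"
    have "(N * z $ a) *\<^sub>R axis a 1 \<in> proj_tensor R" for a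
    proof (cases "\<forall>i. a i \<in> J i")
      case True
      have "norm (axis (a i) 1 :: real^'n) = 1" for i by (simp add: norm_eq_1)
      then have "tensor (\<lambda>i. r i *\<^sub>R axis (a i) 1) \<in> proj_tensor R"
        using True r(1) by (intro tensor_in_proj_tensor r(2))
          (auto simp: coord_space_def axis_def less_imp_le)
      then have ax: "p *\<^sub>R axis a 1 \<in> proj_tensor R"
        by (simp add: tensor_scaleR tensor_axis p_def)
      have "N * \<bar>z $ a\<bar> \<le> N * norm z"
        using N by (intro mult_left_mono component_le_norm_cart) simp
      also have "\<dots> \<le> p" using z(2) N by (simp add: field_simps)
      finally have "N * \<bar>z $ a\<bar> \<le> p" .
      then have "\<bar>N * z $ a / p\<bar> \<le> 1" using N p by (simp add: abs_mult)
      from convex_sym_scaleR[OF conv ax _ this] neg ax p show ?thesis by simp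
    next
      case False
      then have "z $ a = 0" using z by (simp add: tensor_space_def coord_space_def)
      moreover have "tensor (\<lambda>i. 0) \<in> proj_tensor R"
        using sym_convex_body_0[OF subspace_coord_space R] by (intro tensor_in_proj_tensor)
      ultimately show ?thesis by (simp add: tensor_def zero_vec_def zero_power)
    qed
    then have "(\<Sum>a\<in>UNIV. (1 / N) *\<^sub>R (N * z $ a) *\<^sub>R axis a 1) \<in> proj_tensor R"
      using conv N by (intro convex_sum) (auto simp: N_def)
    moreover have "(\<Sum>a\<in>UNIV. (1 / N) *\<^sub>R (N * z $ a) *\<^sub>R axis a 1) = z"
      using N by (simp add: vec_eq_iff axis_def if_distrib cong: if_cong)
    ultimately show "z \<in> proj_tensor R" by simp
  qed (use p N in simp)
qed

lemma proj_tensor_tensorial: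
  assumes R: "\<And>i. sym_convex_body (coord_space (J i)) (R i)"
  shows "proj_tensor R \<in> tensorial_bodies J"
proof -
  have "proj_tensor R \<subseteq> inj_tensor J R"
    using R by (intro proj_tensor_subset_inj_tensor) (simp add: sym_convex_body_def)
  then show ?thesis
    using R sym_convex_body_proj_tensor[OF R]
    by (auto simp: tensorial_bodies_def intro!: exI[of _ R])
qed

text \<open>Each slot contributes one factor \<open>c\<close>. It is enough to check elementary
  tensors, since the preimage of a convex set under scaling is convex.\<close>

lemma near_proj_tensor:
  fixes R S :: "'l::finite \<Rightarrow> (real ^ 'n::finite) set"
  assumes "\<And>i. near c (R i) (S i)"
  shows "near (c ^ CARD('l)) (proj_tensor R) (proj_tensor S)"
proof -
  have *: "z /\<^sub>R c ^ CARD('l) \<in> proj_tensor S"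
    if RS: "\<And>i x. x \<in> R i \<Longrightarrow> x /\<^sub>R c \<in> S i" and z: "z \<in> proj_tensor R"
    for R S :: "'l \<Rightarrow> (real ^ 'n) set" and z
  proof -
    have "proj_tensor R \<subseteq> (\<lambda>z. z /\<^sub>R c ^ CARD('l)) -` proj_tensor S"
    proof (rule proj_tensor_subset)
      show "convex ((\<lambda>z. z /\<^sub>R c ^ CARD('l)) -` proj_tensor S)"
        by (intro convex_linear_vimage) (auto simp: proj_tensor_def linear_scaleR)
      fix x assume "\<And>i. x i \<in> R i"
      then have "tensor (\<lambda>i. inverse c *\<^sub>R x i) \<in> proj_tensor S"
        using RS by (intro tensor_in_proj_tensor) blast
      then show "tensor x \<in> (\<lambda>z. z /\<^sub>R c ^ CARD('l)) -` proj_tensor S"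
        by (simp add: tensor_scaleR power_inverse)
    qed
    then show ?thesis using z by auto
  qed
  show ?thesis using assms *[of R S] *[of S R] unfolding near_def by blast
qed

lemma near_lim_proj_tensor:
  fixes f :: "'b \<Rightarrow> 'l::finite \<Rightarrow> (real ^ 'n::finite) set"
  assumes "\<And>i. near_lim F (\<lambda>x. f x i) (R i)"
  shows "near_lim F (\<lambda>x. proj_tensor (f x)) (proj_tensor R)"
  unfolding near_lim_def
proof (intro allI impI)
  fix c :: real assume c: "c > 1"
  define b where "b = root CARD('l) c"
  have b: "b > 1" "b ^ CARD('l) = c" using c by (auto simp: b_def)
  have "\<forall>\<^sub>F x in F. \<forall>i. near b (f x i) (R i)"
    using assms b by (intro eventually_all_finite) (auto simp: near_lim_def)
  then show "\<forall>\<^sub>F x in F. near c (proj_tensor (f x)) (proj_tensor R)"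
    by eventually_elim (use b near_proj_tensor in blast)
qed

section \<open>Normalised factors and their dependence on the body\<close>

lemma sym_convex_body_scaleR:
  fixes V :: "'a::euclidean_space set"
  assumes V: "subspace V" and Q: "sym_convex_body V Q" and c: "c > 0"
  shows "sym_convex_body V ((*\<^sub>R) c ` Q)"
  unfolding sym_convex_body_iff[OF V]
proof (intro conjI)
  have Q': "Q \<subseteq> V" "compact Q" "convex Q" using Q by (auto simp: sym_convex_body_def)
  show "(*\<^sub>R) c ` Q \<subseteq> V" using Q' V by (auto intro: subspace_scale)
  show "compact ((*\<^sub>R) c ` Q)" using Q' by (intro compact_scaling)
  show "convex ((*\<^sub>R) c ` Q)" using Q' by (intro convex_scaling)
  show "\<forall>x\<in>(*\<^sub>R) c ` Q. - x \<in> (*\<^sub>R) c ` Q"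
    using sym_convex_body_minus[OF Q] by (auto simp flip: scaleR_minus_right)
  obtain r where r: "r > 0" "\<And>x. x \<in> V \<Longrightarrow> norm x \<le> r \<Longrightarrow> x \<in> Q"
    using Q V by (auto simp: sym_convex_body_iff)
  have "x \<in> (*\<^sub>R) c ` Q" if x: "x \<in> V" "norm x \<le> c * r" for x
  proof (rule image_eqI)
    show "x = c *\<^sub>R (x /\<^sub>R c)" using c by simp
    show "x /\<^sub>R c \<in> Q" using x c V by (intro r) (auto simp: subspace_scale field_simps)
  qed
  then show "\<exists>r>0. \<forall>x\<in>V. norm x \<le> r \<longrightarrow> x \<in> (*\<^sub>R) c ` Q"
    using c r by (intro exI[of _ "c * r"]) auto
qed

text \<open>Scaling the factors by positive numbers with product \<open>1\<close> respects both
  tensor bounds. The slots other than \<open>k\<close> can therefore be normalised freely while slot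
  \<open>k\<close> compensates. A polar vector with inner product \<open>1\<close> expresses that
  \<open>e i\<close> is on the boundary.\<close>

lemma normalized_factors_exist:
  fixes R :: "'l::finite \<Rightarrow> (real ^ 'n::finite) set"
  assumes R: "\<And>i. sym_convex_body (coord_space (J i)) (R i)"
    and e: "\<And>i. e i \<in> coord_space (J i)" "\<And>i. e i \<noteq> 0"
  obtains S where "\<And>i. sym_convex_body (coord_space (J i)) (S i)"
    "proj_tensor S \<subseteq> proj_tensor R" "inj_tensor J R \<subseteq> inj_tensor J S"
    "\<And>i. i \<noteq> k \<Longrightarrow> e i \<in> S i \<and> (\<exists>y\<in>polar (coord_space (J i)) (S i). e i \<bullet> y = 1)"
proof -
  have "\<forall>i. \<exists>s y. s > 0 \<and> s *\<^sub>R e i \<in> R i \<and> y \<in> polar (coord_space (J i)) (R i) \<and> (s *\<^sub>R e i) \<bullet> y = 1"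
    using boundary_point_exists[OF subspace_coord_space R e] by blast
  then obtain s y where s: "\<And>i. s i > 0" "\<And>i. s i *\<^sub>R e i \<in> R i"
    and y: "\<And>i. y i \<in> polar (coord_space (J i)) (R i)" "\<And>i. (s i *\<^sub>R e i) \<bullet> y i = 1"
    by metis
  \<comment> \<open>Away from \<open>k\<close> the scalar moves the boundary point
    \<open>s i\<close> times \<open>e i\<close> to \<open>e i\<close>; at \<open>k\<close> it makes
    the total product \<open>1\<close>.\<close>
  define c where "c i = (if i = k then \<Prod>j\<in>UNIV - {k}. s j else 1 / s i)" for i
  define S where "S i = (*\<^sub>R) (c i) ` R i" for i
  have c: "c i > 0" for i using s by (auto simp: c_def prod_pos)
  have "(\<Prod>i\<in>UNIV. c i) = c k * (\<Prod>i\<in>UNIV - {k}. c i)" by (rule prod.remove) auto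
  also have "(\<Prod>i\<in>UNIV - {k}. c i) = (\<Prod>i\<in>UNIV - {k}. 1 / s i)"
    by (rule prod.cong) (auto simp: c_def)
  also have "c k * \<dots> = (\<Prod>i\<in>UNIV - {k}. s i * (1 / s i))"
    unfolding prod.distrib by (simp add: c_def)
  also have "\<dots> = 1" using s(1) by (intro prod.neutral) (simp add: less_imp_neq[symmetric])
  finally have c1: "(\<Prod>i\<in>UNIV. c i) = 1" .
  show ?thesis
  proof
    show "sym_convex_body (coord_space (J i)) (S i)" for i
      unfolding S_def using c by (intro sym_convex_body_scaleR subspace_coord_space R)
    show "proj_tensor S \<subseteq> proj_tensor R"
    proof (rule proj_tensor_subset)
      fix x assume "\<And>i. x i \<in> S i"
      then have "\<forall>i. \<exists>r. r \<in> R i \<and> x i = c i *\<^sub>R r" by (auto simp: S_def)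
      then obtain r where r: "\<And>i. r i \<in> R i" "\<And>i. x i = c i *\<^sub>R r i" by metis
      then have "tensor x = tensor (\<lambda>i. c i *\<^sub>R r i)" by presburger
      then show "tensor x \<in> proj_tensor R" using r by (simp add: tensor_scaleR c1 tensor_in_proj_tensor)
    qed (simp add: proj_tensor_def)
    show "inj_tensor J R \<subseteq> inj_tensor J S"
    proof
      fix z assume z: "z \<in> inj_tensor J R"
      have "\<bar>tensor u \<bullet> z\<bar> \<le> 1" if u: "\<And>i. u i \<in> polar (coord_space (J i)) (S i)" for u
      proof -
        \<comment> \<open>Polars scale inversely to bodies.\<close>
        have "c i *\<^sub>R u i \<in> polar (coord_space (J i)) (R i)" for i
          using u[of i] by (auto simp: polar_def S_def subspace_scale[OF subspace_coord_space])
        then have "\<bar>tensor (\<lambda>i. c i *\<^sub>R u i) \<bullet> z\<bar> \<le> 1"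
          using z unfolding in_inj_tensor_iff by simp
        then show ?thesis by (simp add: tensor_scaleR c1)
      qed
      then show "z \<in> inj_tensor J S" using z by (simp add: in_inj_tensor_iff)
    qed
    fix i assume i: "i \<noteq> k"
    then have ci: "c i = inverse (s i)" by (simp add: c_def inverse_eq_divide)
    have "e i \<in> S i" unfolding S_def
      using s(1,2)[of i] by (intro image_eqI[of _ _ "s i *\<^sub>R e i"]) (auto simp: ci)
    moreover have "s i *\<^sub>R y i \<in> polar (coord_space (J i)) (S i)"
      using y(1)[of i] less_imp_neq[OF s(1)[of i]]
      by (auto simp: polar_def S_def ci subspace_scale[OF subspace_coord_space] simp flip: mult.assoc)
    ultimately show "e i \<in> S i \<and> (\<exists>y\<in>polar (coord_space (J i)) (S i). e i \<bullet> y = 1)"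
      using y(2)[of i] by (auto intro!: bexI[of _ "s i *\<^sub>R y i"])
  qed
qed

text \<open>
  The factors of a tensorial body are unique up to positive scalars with product \<open>1\<close>. They are
  normalised by requiring \<open>e i\<close> to lie on the boundary of the \<open>i\<close>-th factor for \<open>i \<noteq> k\<close>: then the
  \<open>k\<close>-th factor is a section of \<open>Q\<close>, and the \<open>i\<close>-th factor consists of the \<open>x\<close> for which replacing
  \<open>e i\<close> by \<open>x\<close> does not increase the gauge of \<open>Q\<close> at \<open>tensor e\<close>.
\<close>

definition tensor_factor ::
  "'l \<Rightarrow> ('l \<Rightarrow> real ^ 'n) \<Rightarrow> ('l::finite \<Rightarrow> 'n::finite set) \<Rightarrow> (real ^ ('l \<Rightarrow> 'n)) set \<Rightarrow>
    'l \<Rightarrow> (real ^ 'n) set" where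
  "tensor_factor k e J Q i = {x \<in> coord_space (J i).
     \<forall>s. (if i = k then s = 1 else s *\<^sub>R tensor e \<in> Q) \<longrightarrow> s *\<^sub>R tensor (e(i := x)) \<in> Q}"

text \<open>Normalised factors are determined by \<open>Q\<close>: the lower bound puts elementary
  tensors into \<open>Q\<close>, and the upper bound, tested on norming functionals in all slots but
  one, recovers the remaining factor.\<close>

lemma tensor_factor_eq:
  fixes R :: "'l::finite \<Rightarrow> (real ^ 'n::finite) set"
  assumes R: "\<And>i. sym_convex_body (coord_space (J i)) (R i)"
    and e: "\<And>i. e i \<in> coord_space (J i)" "\<And>i. e i \<noteq> 0"
    and norm: "\<And>i. i \<noteq> k \<Longrightarrow> e i \<in> R i \<and> (\<exists>y\<in>polar (coord_space (J i)) (R i). e i \<bullet> y = 1)"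
    and Q: "proj_tensor R \<subseteq> Q" "Q \<subseteq> inj_tensor J R"
  shows "tensor_factor k e J Q = R"
proof
  fix i
  have RV: "R i \<subseteq> coord_space (J i)" for i using R by (simp add: sym_convex_body_def)
  obtain y where y: "\<And>i. i \<noteq> k \<Longrightarrow> y i \<in> polar (coord_space (J i)) (R i)"
    "\<And>i. i \<noteq> k \<Longrightarrow> e i \<bullet> y i = 1"
    using norm by metis
  \<comment> \<open>The vectors \<open>v i\<close> norm \<open>u i\<close> in every slot except
    \<open>j\<close>, so the product of inner products collapses to \<open>x \<bullet> z\<close>,
    which the injective bound controls.\<close>
  have pairing: "x \<in> R j"
    if x: "x \<in> coord_space (J j)" and u: "tensor u \<in> Q" "u j = x"
      and v: "\<And>i. i \<noteq> j \<Longrightarrow> v i \<in> polar (coord_space (J i)) (R i)"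
        "\<And>i. i \<noteq> j \<Longrightarrow> u i \<bullet> v i = 1" for x j and u v :: "'l \<Rightarrow> real ^ 'n"
  proof (rule bipolar[OF subspace_coord_space R x])
    fix z assume z: "z \<in> polar (coord_space (J j)) (R j)"
    have "tensor (v(j := z)) \<bullet> tensor u = (\<Prod>i\<in>UNIV. if i = j then x \<bullet> z else 1)"
      unfolding inner_tensor using u v by (intro prod.cong) (auto simp: inner_commute)
    then have "tensor (v(j := z)) \<bullet> tensor u = x \<bullet> z" by simp
    moreover have "\<bar>tensor (v(j := z)) \<bullet> tensor u\<bar> \<le> 1"
      using u(1) Q(2) v(1) z by (fastforce simp: in_inj_tensor_iff)
    ultimately show "\<bar>x \<bullet> z\<bar> \<le> 1" by simp
  qed
  have sect: "tensor (e(k := x)) \<in> Q \<longleftrightarrow> x \<in> R k" if x: "x \<in> coord_space (J k)" for x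
  proof
    assume "tensor (e(k := x)) \<in> Q"
    then show "x \<in> R k" using pairing[OF x, of "e(k := x)" y] y by simp
  next
    assume "x \<in> R k"
    then have "tensor (e(k := x)) \<in> proj_tensor R" using norm by (intro tensor_in_proj_tensor) auto
    then show "tensor (e(k := x)) \<in> Q" using Q by blast
  qed
  \<comment> \<open>A scalar in front of a tensor can be moved into slot \<open>k\<close>, where
    membership in \<open>Q\<close> is membership in \<open>R k\<close>.\<close>
  have scaled_e: "s *\<^sub>R tensor e \<in> Q \<longleftrightarrow> s *\<^sub>R e k \<in> R k" for s
    using sect[of "s *\<^sub>R e k"] tensor_scaleR_upd[of e k s "e k"]
    by (simp add: subspace_scale[OF subspace_coord_space] e)
  have scaled_upd: "s *\<^sub>R tensor (e(i := x)) = tensor (e(i := x, k := s *\<^sub>R e k))" if "i \<noteq> k" for s x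
    using tensor_scaleR_upd[of "e(i := x)" k s "e k"] that by (simp add: fun_upd_idem)
  show "tensor_factor k e J Q i = R i"
  proof (cases "i = k")
    case True
    then show ?thesis using sect RV by (auto simp: tensor_factor_def)
  next
    case False
    show ?thesis
    proof (intro equalityI subsetI)
      fix x assume x: "x \<in> tensor_factor k e J Q i"
      \<comment> \<open>The extremal scalar is taken: \<open>s\<close> puts the multiple of
        \<open>e k\<close> on the boundary of \<open>R k\<close>, so that \<open>w\<close> norms it
        and \<open>pairing\<close> applies in slot \<open>i\<close>.\<close>
      obtain s w where s: "s *\<^sub>R e k \<in> R k" "w \<in> polar (coord_space (J k)) (R k)" "(s *\<^sub>R e k) \<bullet> w = 1"
        using boundary_point_exists[OF subspace_coord_space R e] by blast
      have "tensor (e(i := x, k := s *\<^sub>R e k)) \<in> Q"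
        using x s False by (simp add: tensor_factor_def scaled_e flip: scaled_upd)
      then show "x \<in> R i"
        using x s y False pairing[of x i "e(i := x, k := s *\<^sub>R e k)" "y(k := w)"]
        by (simp add: tensor_factor_def)
    next
      fix x assume x: "x \<in> R i"
      have "tensor (e(i := x, k := s *\<^sub>R e k)) \<in> Q" if "s *\<^sub>R e k \<in> R k" for s
      proof -
        have "tensor (e(i := x, k := s *\<^sub>R e k)) \<in> proj_tensor R"
          using norm x that by (intro tensor_in_proj_tensor) auto
        then show ?thesis using Q by blast
      qed
      then show "x \<in> tensor_factor k e J Q i"
        using x RV False by (auto simp: tensor_factor_def scaled_e scaled_upd)
    qed
  qed
qed

text \<open>Any witnesses can be normalised, and the normalised ones are given by the formula. The
  existential choice of factors thus becomes a function of \<open>Q\<close>.\<close>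

lemma tensor_factor_tensorial:
  fixes J :: "'l::finite \<Rightarrow> 'n::finite set"
  assumes e: "\<And>i. e i \<in> coord_space (J i)" "\<And>i. e i \<noteq> 0" and Q: "Q \<in> tensorial_bodies J"
  shows "(\<forall>i. sym_convex_body (coord_space (J i)) (tensor_factor k e J Q i)) \<and>
    proj_tensor (tensor_factor k e J Q) \<subseteq> Q \<and> Q \<subseteq> inj_tensor J (tensor_factor k e J Q)"
proof -
  obtain R where R: "\<And>i. sym_convex_body (coord_space (J i)) (R i)"
    "proj_tensor R \<subseteq> Q" "Q \<subseteq> inj_tensor J R"
    using Q by (auto simp: tensorial_bodies_def)
  obtain S where S: "\<And>i. sym_convex_body (coord_space (J i)) (S i)"
    "proj_tensor S \<subseteq> proj_tensor R" "inj_tensor J R \<subseteq> inj_tensor J S"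
    "\<And>i. i \<noteq> k \<Longrightarrow> e i \<in> S i \<and> (\<exists>y\<in>polar (coord_space (J i)) (S i). e i \<bullet> y = 1)"
    using normalized_factors_exist[of J R e k] R(1) e by metis
  have Q': "proj_tensor S \<subseteq> Q" "Q \<subseteq> inj_tensor J S" using R S by auto
  show ?thesis using tensor_factor_eq[OF S(1) e S(4) Q'] S(1) Q' by simp
qed

text \<open>For \<open>i \<noteq> k\<close> the body occurs in the premise and in the conclusion of
  the defining implication, and each passage between \<open>A\<close> and \<open>B\<close> costs one
  factor \<open>c\<close>. In slot \<open>k\<close> one factor is enough and the other is a
  shrinking.\<close>

lemma near_tensor_factor:
  assumes A: "sym_convex_body (tensor_space J) A" and B: "sym_convex_body (tensor_space J) B"
    and c: "c \<ge> 1" and near: "near c A B"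
  shows "near (c * c) (tensor_factor k e J A i) (tensor_factor k e J B i)"
proof -
  have *: "x /\<^sub>R (c * c) \<in> tensor_factor k e J B i"
    if B: "sym_convex_body (tensor_space J) B"
      and AB: "\<And>a. a \<in> A \<Longrightarrow> a /\<^sub>R c \<in> B" and BA: "\<And>b. b \<in> B \<Longrightarrow> b /\<^sub>R c \<in> A"
      and x: "x \<in> tensor_factor k e J A i" for A B x
  proof -
    have "s *\<^sub>R tensor (e(i := x /\<^sub>R (c * c))) \<in> B"
      if s: "if i = k then s = 1 else s *\<^sub>R tensor e \<in> B" for s
    proof (cases "i = k")
      case True
      have "tensor (e(i := x)) \<in> A" using x True by (simp add: tensor_factor_def)
      then have "inverse c *\<^sub>R (tensor (e(i := x)) /\<^sub>R c) \<in> B"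
        using c by (intro sym_convex_body_shrink[OF subspace_tensor_space B] AB)
          (auto simp: inverse_le_1_iff)
      then show ?thesis using s True by (simp add: tensor_scaleR_upd)
    next
      case False
      have "(s * inverse c) *\<^sub>R tensor e \<in> A" using BA[of "s *\<^sub>R tensor e"] s False by (simp add: mult.commute)
      then have "(s * inverse c) *\<^sub>R tensor (e(i := x)) \<in> A"
        using x False by (simp add: tensor_factor_def)
      from AB[OF this] show ?thesis by (simp add: tensor_scaleR_upd mult_ac)
    qed
    then show ?thesis using x by (auto simp: tensor_factor_def subspace_scale[OF subspace_coord_space])
  qed
  show ?thesis
    using near *[OF B, of A] *[OF A, of B] unfolding near_def by blast
qed

lemma near_lim_tensor_factor:
  assumes f: "near_lim F f Q" "\<forall>\<^sub>F x in F. sym_convex_body (tensor_space J) (f x)"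
    and Q: "sym_convex_body (tensor_space J) Q"
  shows "near_lim F (\<lambda>x. tensor_factor k e J (f x) i) (tensor_factor k e J Q i)"
  unfolding near_lim_def
proof (intro allI impI)
  fix c :: real assume c: "c > 1"
  define b where "b = sqrt c"
  have b: "b > 1" "b * b = c" using c by (auto simp: b_def)
  have "\<forall>\<^sub>F x in F. near b (f x) Q" using f b by (auto simp: near_lim_def)
  then show "\<forall>\<^sub>F x in F. near c (tensor_factor k e J (f x) i) (tensor_factor k e J Q i)"
    using f(2)
  proof eventually_elim
    case (elim x)
    then show ?case using near_tensor_factor[of J "f x" Q b k e i] Q b by simp
  qed
qed

subsection \<open>The contraction\<close>

lemma limitin_tensorial_bodies_iff:
  "limitin (tensorial_bodies_topology J) f Q F \<longleftrightarrow>
     Q \<in> tensorial_bodies J \<and> (\<forall>\<^sub>F x in F. f x \<in> tensorial_bodies J) \<and> near_lim F f Q"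
proof -
  interpret Metric_space "tensorial_bodies J" "hausdorff_dist (tensor_space J)"
    by (rule Metric_space.subspace[OF Metric_space_hausdorff_dist[OF subspace_tensor_space]])
      (auto simp: tensorial_bodies_def)
  have "near_lim F f Q \<longleftrightarrow> (\<forall>e>0. \<forall>\<^sub>F x in F. hausdorff_dist (tensor_space J) (f x) Q < e)"
    if "Q \<in> tensorial_bodies J" "\<forall>\<^sub>F x in F. f x \<in> tensorial_bodies J"
    using that
    by (intro near_lim_iff_hausdorff subspace_tensor_space)
      (auto simp: tensorial_bodies_def elim!: eventually_mono)
  moreover have "(\<forall>e>0. P \<and> R e) \<longleftrightarrow> P \<and> (\<forall>e>0. R e)" for P and R :: "real \<Rightarrow> bool"
    using zero_less_one by blast
  ultimately show ?thesis
    unfolding tensorial_bodies_topology_def limitin_metric eventually_conj_iff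
    by (simp cong: conj_cong)
qed

lemma homotopic_with_tensorial_bodies:
  fixes h :: "real \<Rightarrow> (real ^ ('l::finite \<Rightarrow> 'n::finite)) set \<Rightarrow> (real ^ ('l \<Rightarrow> 'n)) set"
  assumes h: "\<And>t Q. 0 \<le> t \<Longrightarrow> t \<le> 1 \<Longrightarrow> Q \<in> tensorial_bodies J \<Longrightarrow> h t Q \<in> tensorial_bodies J"
    and lim: "\<And>F t Q. 0 \<le> t \<Longrightarrow> t \<le> 1 \<Longrightarrow> Q \<in> tensorial_bodies J \<Longrightarrow> (fst \<longlongrightarrow> t) F \<Longrightarrow>
      \<forall>\<^sub>F z in F. 0 \<le> fst z \<and> fst z \<le> 1 \<Longrightarrow> \<forall>\<^sub>F z in F. snd z \<in> tensorial_bodies J \<Longrightarrow>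
      near_lim F snd Q \<Longrightarrow> near_lim F (\<lambda>z. h (fst z) (snd z)) (h t Q)"
    and h01: "\<And>Q. Q \<in> tensorial_bodies J \<Longrightarrow> h 0 Q = f Q"
      "\<And>Q. Q \<in> tensorial_bodies J \<Longrightarrow> h 1 Q = g Q"
  shows "homotopic_with (\<lambda>_. True) (tensorial_bodies_topology J) (tensorial_bodies_topology J) f g"
proof -
  let ?X = "tensorial_bodies_topology J"
  let ?Z = "prod_topology (top_of_set {0..1::real}) ?X"
  have "limitin ?X (\<lambda>z. h (fst z) (snd z)) (h (fst z) (snd z)) (atin ?Z z)"
    if z: "z \<in> topspace ?Z" for z
  proof -
    have t: "0 \<le> fst z" "fst z \<le> 1" and Q: "snd z \<in> tensorial_bodies J" using z by auto
    have ev: "\<forall>\<^sub>F z in atin ?Z z. z \<in> topspace ?Z"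
      by (auto simp: atin_def eventually_inf_principal)
    have 1: "\<forall>\<^sub>F z in atin ?Z z. 0 \<le> fst z \<and> fst z \<le> 1"
      and 2: "\<forall>\<^sub>F z in atin ?Z z. snd z \<in> tensorial_bodies J"
      using ev by (auto elim!: eventually_mono)
    have "limitin (top_of_set {0..1}) fst (fst z) (atin ?Z z)"
      using continuous_map_fst[of "top_of_set {0..1}" ?X, unfolded continuous_map_atin] z by (rule bspec)
    then have 3: "(fst \<longlongrightarrow> fst z) (atin ?Z z)" by (simp add: limitin_subtopology)
    have "limitin ?X snd (snd z) (atin ?Z z)"
      using continuous_map_snd[of "top_of_set {0..1}" ?X, unfolded continuous_map_atin] z by (rule bspec)
    then have 4: "near_lim (atin ?Z z) snd (snd z)" by (simp add: limitin_tensorial_bodies_iff)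
    have "\<forall>\<^sub>F z in atin ?Z z. h (fst z) (snd z) \<in> tensorial_bodies J"
      using 1 2 by eventually_elim (auto intro: h)
    then show ?thesis
      using lim[OF t Q 3 1 2 4] h[OF t Q] by (simp add: limitin_tensorial_bodies_iff)
  qed
  then have "continuous_map ?Z ?X (\<lambda>z. h (fst z) (snd z))" by (simp add: continuous_map_atin)
  then show ?thesis
    using h01 by (subst homotopic_with) (auto intro!: exI[of _ "\<lambda>z. h (fst z) (snd z)"])
qed

theorem proposition3p5:
  fixes d :: "'l::finite \<Rightarrow> nat" and J :: "'l \<Rightarrow> 'n::finite set"
  assumes "CARD('l) \<ge> 2"
    and "\<And>i. d i \<ge> 2"
    and "\<And>i. card (J i) = d i"
  shows "contractible_space (tensorial_bodies_topology J)"
proof -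
  let ?X = "tensorial_bodies_topology J"
  have "\<exists>j. j \<in> J i" for i using assms(2,3)[of i] by (cases "J i = {}") auto
  then obtain a where a: "\<And>i. a i \<in> J i" by metis
  define e :: "'l \<Rightarrow> real ^ 'n" where "e i = axis (a i) 1" for i
  have e: "e i \<in> coord_space (J i)" "e i \<noteq> 0" for i
    using a by (auto simp: e_def coord_space_def axis_def vec_eq_iff)
  fix k :: 'l
  define T where "T Q = tensor_factor k e J Q" for Q
  define D :: "'l \<Rightarrow> (real ^ 'n) set" where "D i = coord_space (J i) \<inter> cball 0 1" for i
  have D: "sym_convex_body (coord_space (J i)) (D i)" for i
    unfolding sym_convex_body_iff[OF subspace_coord_space]
  proof (intro conjI)
    show "compact (D i)" unfolding D_def
      by (intro closed_Int_compact closed_subspace subspace_coord_space compact_cball)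
    show "convex (D i)" unfolding D_def
      by (intro convex_Int subspace_imp_convex subspace_coord_space convex_cball)
    show "\<exists>r>0. \<forall>x\<in>coord_space (J i). norm x \<le> r \<longrightarrow> x \<in> D i"
      by (auto simp: D_def intro!: exI[of _ 1])
  qed (auto simp: D_def subspace_neg[OF subspace_coord_space])
  have body: "sym_convex_body (tensor_space J) Q" if "Q \<in> tensorial_bodies J" for Q
    using that by (simp add: tensorial_bodies_def)
  have T: "sym_convex_body (coord_space (J i)) (T Q i)" "proj_tensor (T Q) \<subseteq> Q"
    "Q \<subseteq> inj_tensor J (T Q)" if "Q \<in> tensorial_bodies J" for Q i
    using tensor_factor_tensorial[OF e that, where k = k] by (auto simp: T_def)
  have T_lim: "near_lim F (\<lambda>x. T (f x) i) (T Q i)"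
    if "near_lim F f Q" "\<forall>\<^sub>F x in F. f x \<in> tensorial_bodies J" "Q \<in> tensorial_bodies J"
    for i Q and F :: "(real \<times> (real ^ ('l \<Rightarrow> 'n)) set) filter" and f
    unfolding T_def using that body
    by (intro near_lim_tensor_factor) (auto elim: eventually_mono)
  have proj_T: "sym_convex_body (tensor_space J) (proj_tensor (T Q))" if "Q \<in> tensorial_bodies J" for Q
    using T(1)[OF that] by (rule sym_convex_body_proj_tensor)
  have "homotopic_with (\<lambda>_. True) ?X ?X id (\<lambda>Q. proj_tensor (T Q))"
  proof (rule homotopic_with_tensorial_bodies[where h = "\<lambda>t Q. minkowski_comb t Q (proj_tensor (T Q))"])
    fix t :: real and Q assume t: "0 \<le> t" "t \<le> 1" and Q: "Q \<in> tensorial_bodies J"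
    have "minkowski_comb t Q (proj_tensor (T Q)) \<subseteq> inj_tensor J (T Q)"
      using T(2,3)[OF Q] t by (intro minkowski_comb_subset convex_inj_tensor) auto
    moreover have "proj_tensor (T Q) \<subseteq> minkowski_comb t Q (proj_tensor (T Q))"
      using T(2)[OF Q] minkowski_comb_self[of Q "proj_tensor (T Q)" t] by blast
    ultimately show "minkowski_comb t Q (proj_tensor (T Q)) \<in> tensorial_bodies J"
      using T(1)[OF Q] sym_convex_body_minkowski_comb[OF subspace_tensor_space body[OF Q] proj_T[OF Q] t]
      unfolding tensorial_bodies_def by blast
    fix F :: "(real \<times> (real ^ ('l \<Rightarrow> 'n)) set) filter"
    assume F: "(fst \<longlongrightarrow> t) F" "\<forall>\<^sub>F z in F. 0 \<le> fst z \<and> fst z \<le> 1"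
      "\<forall>\<^sub>F z in F. snd z \<in> tensorial_bodies J" "near_lim F snd Q"
    show "near_lim F (\<lambda>z. minkowski_comb (fst z) (snd z) (proj_tensor (T (snd z)))) (minkowski_comb t Q (proj_tensor (T Q)))"
      using T_lim[OF F(4,3) Q]
      by (intro near_lim_minkowski_comb[OF subspace_tensor_space body[OF Q] proj_T[OF Q] F(1,2) t F(4)]
          near_lim_proj_tensor)
  next
    fix Q assume Q: "Q \<in> tensorial_bodies J"
    show "minkowski_comb 0 Q (proj_tensor (T Q)) = id Q" "minkowski_comb 1 Q (proj_tensor (T Q)) = proj_tensor (T Q)"
      using sym_convex_body_0[OF subspace_tensor_space body[OF Q]]
        sym_convex_body_0[OF subspace_tensor_space proj_T[OF Q]]
      by (auto intro!: minkowski_comb_0 minkowski_comb_1)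
  qed
  moreover have "homotopic_with (\<lambda>_. True) ?X ?X (\<lambda>Q. proj_tensor (T Q)) (\<lambda>_. proj_tensor D)"
  proof (rule homotopic_with_tensorial_bodies[where h = "\<lambda>t Q. proj_tensor (\<lambda>i. minkowski_comb t (T Q i) (D i))"])
    fix t :: real and Q assume t: "0 \<le> t" "t \<le> 1" and Q: "Q \<in> tensorial_bodies J"
    show "proj_tensor (\<lambda>i. minkowski_comb t (T Q i) (D i)) \<in> tensorial_bodies J"
      by (intro proj_tensor_tensorial sym_convex_body_minkowski_comb subspace_coord_space T(1) D Q t)
    fix F :: "(real \<times> (real ^ ('l \<Rightarrow> 'n)) set) filter"
    assume F: "(fst \<longlongrightarrow> t) F" "\<forall>\<^sub>F z in F. 0 \<le> fst z \<and> fst z \<le> 1"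
      "\<forall>\<^sub>F z in F. snd z \<in> tensorial_bodies J" "near_lim F snd Q"
    show "near_lim F (\<lambda>z. proj_tensor (\<lambda>i. minkowski_comb (fst z) (T (snd z) i) (D i)))
        (proj_tensor (\<lambda>i. minkowski_comb t (T Q i) (D i)))"
      by (intro near_lim_proj_tensor near_lim_minkowski_comb[OF subspace_coord_space T(1)[OF Q] D F(1,2) t]
          T_lim[OF F(4,3) Q] near_lim_const[OF subspace_coord_space D])
  next
    fix Q assume Q: "Q \<in> tensorial_bodies J"
    have "T Q i \<noteq> {}" "D i \<noteq> {}" for i
      using sym_convex_body_0[OF subspace_coord_space T(1)[OF Q]]
        sym_convex_body_0[OF subspace_coord_space D] by blast+
    then show "proj_tensor (\<lambda>i. minkowski_comb 0 (T Q i) (D i)) = proj_tensor (T Q)"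
      "proj_tensor (\<lambda>i. minkowski_comb 1 (T Q i) (D i)) = proj_tensor D"
      by (simp_all add: minkowski_comb_0 minkowski_comb_1)
  qed
  ultimately show ?thesis
    unfolding contractible_space_def by (blast intro: homotopic_with_trans)
qed

end
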